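(* There exists a family $\{\mathcal{I}_p : 2<p<\infty\}$, indexed by the real numbers $p\in(2,\infty)$, of non-closed ideals in $L(L_1)$ such that their closures $\overline{\mathcal{I}_p}$, $2<p<\infty$, are small ideals in $L(L_1)$ and are distinct, i.e. $\overline{\mathcal{I}_p}\neq\overline{\mathcal{I}_q}$ whenever $p\neq q$.
   Context: $L_1:=L_1(0,1)$ with Lebesgue measure, over the real or complex scalars. For a Banach space $X$, $L(X)$ is the Banach algebra of bounded linear operators on $X$ with the operator norm; "ideal" always means two-sided ideal, and closures are taken in the operator norm. An operator $T:X\to Y$ between Banach spaces is strictly singular if there is no infinite dimensional Banach space $Z$ and operator $S:Z\to X$ such that $TS$ is an isomorphism onto its image (equivalently, $T$ is not an isomorphism onto its image when restricted to any infinite dimensional closed subspace of $X$). An ideal in $L(X)$ is called small if it is contained in the ideal of strictly singular operators on $X$. *)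

theory Defs
  imports "HOL-Analysis.Analysis"
begin

section \<open>The Banach space \<open>L\<^sub>1(0,1)\<close>\<close>

text \<open>Only the values on the open unit interval matter: representatives are total functions
  on the real line, but two of them are identified as soon as they agree almost everywhere
  on \<open>(0,1)\<close>. The scalar field is a type parameter, to be instantiated by
  \<^typ>\<open>real\<close> and by \<^typ>\<open>complex\<close>.\<close>

abbreviation leb01 :: "real measure" where
  "leb01 \<equiv> lebesgue_on {0<..<1}"

definition L1_rel :: "(real \<Rightarrow> 'k::{real_normed_field, banach, second_countable_topology}) \<Rightarrow> (real \<Rightarrow> 'k) \<Rightarrow> bool" where
  "L1_rel f g \<longleftrightarrow> integrable leb01 f \<and> integrable leb01 g \<and> (AE x in leb01. f x = g x)"

lemma part_equivp_L1_rel: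
  "part_equivp (L1_rel :: (real \<Rightarrow> 'k::{real_normed_field, banach, second_countable_topology}) \<Rightarrow> _)"
proof (rule part_equivpI)
  show "\<exists>f::real \<Rightarrow> 'k. L1_rel f f"
    by (rule exI[of _ "\<lambda>_. 0"]) (simp add: L1_rel_def)
  show "symp (L1_rel :: (real \<Rightarrow> 'k) \<Rightarrow> _)"
    by (rule sympI) (auto simp: L1_rel_def elim: eventually_mono)
  show "transp (L1_rel :: (real \<Rightarrow> 'k) \<Rightarrow> _)"
    by (rule transpI) (auto simp: L1_rel_def elim: eventually_elim2)
qed

quotient_type (overloaded) 'k L1 =
  "real \<Rightarrow> 'k::{real_normed_field, banach, second_countable_topology}" / partial: L1_rel
  by (rule part_equivp_L1_rel)

lift_definition scaleL1 ::
  "'k \<Rightarrow> 'k L1 \<Rightarrow> 'k::{real_normed_field, banach, second_countable_topology} L1" (infixr "*\<^sub>1" 75)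
  is "\<lambda>c f x. c * f x"
  by (auto simp: L1_rel_def elim: eventually_mono)

instantiation L1 :: ("{real_normed_field, banach, second_countable_topology}") real_normed_vector
begin

lift_definition zero_L1 :: "'a L1" is "\<lambda>_. 0"
  by (simp add: L1_rel_def)

lift_definition plus_L1 :: "'a L1 \<Rightarrow> 'a L1 \<Rightarrow> 'a L1" is "\<lambda>f g x. f x + g x"
  by (auto simp: L1_rel_def elim: eventually_elim2)

lift_definition minus_L1 :: "'a L1 \<Rightarrow> 'a L1 \<Rightarrow> 'a L1" is "\<lambda>f g x. f x - g x"
  by (auto simp: L1_rel_def elim: eventually_elim2)

lift_definition uminus_L1 :: "'a L1 \<Rightarrow> 'a L1" is "\<lambda>f x. - f x"
  by (auto simp: L1_rel_def elim: eventually_mono)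

lift_definition scaleR_L1 :: "real \<Rightarrow> 'a L1 \<Rightarrow> 'a L1" is "\<lambda>r f x. r *\<^sub>R f x"
  by (auto simp: L1_rel_def elim: eventually_mono)

lift_definition norm_L1 :: "'a L1 \<Rightarrow> real" is "\<lambda>f. LINT x|leb01. norm (f x)"
  by (auto simp: L1_rel_def elim: eventually_mono intro!: integral_cong_AE)

definition dist_L1 :: "'a L1 \<Rightarrow> 'a L1 \<Rightarrow> real" where
  "dist_L1 a b = norm (a - b)"

definition sgn_L1 :: "'a L1 \<Rightarrow> 'a L1" where
  "sgn_L1 a = inverse (norm a) *\<^sub>R a"

definition uniformity_L1 :: "('a L1 \<times> 'a L1) filter" where
  "uniformity_L1 = (INF e\<in>{0<..}. principal {(a, b). dist a b < e})"

definition open_L1 :: "'a L1 set \<Rightarrow> bool" where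
  "open_L1 U \<longleftrightarrow> (\<forall>a\<in>U. \<forall>\<^sub>F (a', b) in uniformity. a' = a \<longrightarrow> b \<in> U)"

instance
proof
  fix a b c :: "'a L1" and r s :: real and U :: "'a L1 set"
  show "a + b + c = a + (b + c)" "a + b = b + a" "0 + a = a" "- a + a = 0" "a - b = a + - b"
    by (transfer, auto simp: L1_rel_def algebra_simps; fail)+
  show "r *\<^sub>R (a + b) = r *\<^sub>R a + r *\<^sub>R b" "(r + s) *\<^sub>R a = r *\<^sub>R a + s *\<^sub>R a"
    "r *\<^sub>R s *\<^sub>R a = (r * s) *\<^sub>R a" "1 *\<^sub>R a = a"
    by (transfer, auto simp: L1_rel_def algebra_simps)+
  show "dist a b = norm (a - b)" "sgn a = inverse (norm a) *\<^sub>R a"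
    "uniformity = (INF e\<in>{0<..}. principal {(a, b :: 'a L1). dist a b < e})"
    "open U \<longleftrightarrow> (\<forall>a\<in>U. \<forall>\<^sub>F (a', b) in uniformity. a' = a \<longrightarrow> b \<in> U)"
    by (fact dist_L1_def sgn_L1_def uniformity_L1_def open_L1_def)+
  show "norm a = 0 \<longleftrightarrow> a = 0"
    by transfer (auto simp: L1_rel_def integral_nonneg_eq_0_iff_AE)
  show "norm (a + b) \<le> norm a + norm b"
  proof transfer
    fix f g :: "real \<Rightarrow> 'a"
    assume "L1_rel f f" "L1_rel g g"
    then have *: "integrable leb01 f" "integrable leb01 g"
      by (auto simp: L1_rel_def)
    then have "(LINT x|leb01. norm (f x + g x)) \<le> (LINT x|leb01. norm (f x) + norm (g x))"
      by (intro integral_mono) (auto intro: norm_triangle_ineq)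
    with * show "(LINT x|leb01. norm (f x + g x)) \<le> (LINT x|leb01. norm (f x)) + (LINT x|leb01. norm (g x))"
      by simp
  qed
  show "norm (r *\<^sub>R a) = \<bar>r\<bar> * norm a"
    by transfer simp
qed

end

instance L1 :: ("{real_normed_field, banach, second_countable_topology}") banach
proof
  fix X :: "nat \<Rightarrow> 'a L1"
  assume X: "Cauchy X"
  define s where "s n = rep_L1 (X n)" for n
  have s_rel: "L1_rel (s n) (s n)" and X_eq: "X n = abs_L1 (s n)" for n
    using Quotient3_rep_reflp[OF Quotient3_L1, of "X n"] Quotient3_abs_rep[OF Quotient3_L1, of "X n"]
    by (simp_all add: s_def)
  have int[measurable]: "integrable leb01 (s n)" for n
    using s_rel by (simp add: L1_rel_def)
  note meas[measurable] = borel_measurable_integrable[OF int]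
  have norm_abs: "norm (abs_L1 f) = (LINT x|leb01. norm (f x))" if "integrable leb01 f" for f :: "real \<Rightarrow> 'a"
    using that by (simp add: norm_L1.abs_eq L1_rel_def)
  have diff_abs: "abs_L1 f - abs_L1 g = abs_L1 (\<lambda>x. f x - g x)"
    if "integrable leb01 f" "integrable leb01 g" for f g :: "real \<Rightarrow> 'a"
    using that by (simp add: minus_L1.abs_eq L1_rel_def)
  have norm_X: "norm (X i - X j) = (LINT x|leb01. norm (s i x - s j x))" for i j
    by (simp add: X_eq diff_abs norm_abs int)
  have cau: "\<exists>N. \<forall>i\<ge>N. \<forall>j\<ge>N. (LINT x|leb01. norm (s i x - s j x)) < e" if e: "e > 0" for e
    using X e unfolding Cauchy_def dist_norm norm_X by blast
  obtain r where r: "strict_mono r" and AEr: "AE x in leb01. Cauchy (\<lambda>i. s (r i) x)"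
    by (rule cauchy_L1_AE_cauchy_subseq[OF int cau])
  define g where "g x = lim (\<lambda>i. s (r i) x)" for x
  have g_meas[measurable]: "g \<in> borel_measurable leb01"
    unfolding g_def by measurable
  have AEg: "AE x in leb01. (\<lambda>i. s (r i) x) \<longlonglongrightarrow> g x"
    using AEr by eventually_elim (auto simp: g_def Cauchy_convergent_iff convergent_LIMSEQ_iff)
  have key: "\<exists>N. \<forall>j\<ge>N. (\<integral>\<^sup>+x. norm (s (r j) x - g x) \<partial>leb01) \<le> ennreal e" if e: "e > 0" for e
  proof -
    obtain N where N: "\<And>i j. i \<ge> N \<Longrightarrow> j \<ge> N \<Longrightarrow> (LINT x|leb01. norm (s i x - s j x)) < e"
      using cau[OF e] by blast
    have "(\<integral>\<^sup>+x. norm (s (r j) x - g x) \<partial>leb01) \<le> ennreal e" if j: "j \<ge> N" for j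
    proof -
      have "(\<integral>\<^sup>+x. norm (s (r j) x - g x) \<partial>leb01)
          = (\<integral>\<^sup>+x. liminf (\<lambda>i. ennreal (norm (s (r j) x - s (r i) x))) \<partial>leb01)"
      proof (rule nn_integral_cong_AE, use AEg in eventually_elim)
        fix x assume "(\<lambda>i. s (r i) x) \<longlonglongrightarrow> g x"
        then have "(\<lambda>i. ennreal (norm (s (r j) x - s (r i) x))) \<longlonglongrightarrow> ennreal (norm (s (r j) x - g x))"
          by (intro tendsto_intros)
        then show "ennreal (norm (s (r j) x - g x)) = liminf (\<lambda>i. ennreal (norm (s (r j) x - s (r i) x)))"
          using lim_imp_Liminf[OF sequentially_bot] by metis
      qed
      also have "\<dots> \<le> liminf (\<lambda>i. \<integral>\<^sup>+x. norm (s (r j) x - s (r i) x) \<partial>leb01)"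
        by (rule nn_integral_liminf) measurable
      also have "\<dots> \<le> liminf (\<lambda>i::nat. ennreal e)"
      proof (rule Liminf_mono)
        show "\<forall>\<^sub>F i in sequentially. (\<integral>\<^sup>+x. norm (s (r j) x - s (r i) x) \<partial>leb01) \<le> ennreal e"
          using eventually_ge_at_top[of N]
        proof eventually_elim
          case (elim i)
          have "r i \<ge> N" "r j \<ge> N"
            using elim j seq_suble[OF r, of i] seq_suble[OF r, of j] by simp_all
          then have "(LINT x|leb01. norm (s (r j) x - s (r i) x)) \<le> e"
            using N less_imp_le by blast
          then show ?case
            by (subst nn_integral_eq_integral) (auto simp: int intro!: ennreal_leI)
        qed
      qed
      finally show ?thesis
        by (simp add: Liminf_const)
    qed
    then show ?thesis by blast
  qed
  obtain N where "(\<integral>\<^sup>+x. norm (s (r N) x - g x) \<partial>leb01) \<le> ennreal 1"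
    using key[of 1] by auto
  then have int_diff: "integrable leb01 (\<lambda>x. s (r N) x - g x)"
    by (intro integrableI_bounded) (auto simp: le_less_trans)
  have int_g: "integrable leb01 g"
    using Bochner_Integration.integrable_diff[OF int[of "r N"] int_diff] by (simp del: Bochner_Integration.integrable_diff)
  have "(X \<circ> r) \<longlonglongrightarrow> abs_L1 g"
  proof (rule LIMSEQ_I)
    fix e :: real assume "e > 0"
    then obtain N where N: "\<And>j. j \<ge> N \<Longrightarrow> (\<integral>\<^sup>+x. norm (s (r j) x - g x) \<partial>leb01) \<le> ennreal (e / 2)"
      using key[of "e / 2"] by auto
    have "norm ((X \<circ> r) j - abs_L1 g) < e" if "j \<ge> N" for j
    proof -
      have "ennreal (LINT x|leb01. norm (s (r j) x - g x)) \<le> ennreal (e / 2)"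
        using N[OF that] by (subst (asm) nn_integral_eq_integral) (auto simp: int int_g)
      with \<open>e > 0\<close> show ?thesis
        by (simp add: X_eq diff_abs norm_abs int int_g)
    qed
    then show "\<exists>N. \<forall>j\<ge>N. norm ((X \<circ> r) j - abs_L1 g) < e" by blast
  qed
  then show "convergent X"
    using Cauchy_converges_subseq[OF X r] by (auto simp: convergent_def o_def)
qed

lemma norm_scaleL1: "norm (c *\<^sub>1 a) = norm c * norm a"
  by transfer (simp add: norm_mult)

lemma scaleR_L1_eq: "r *\<^sub>R a = of_real r *\<^sub>1 a"
  by transfer (simp add: L1_rel_def scaleR_conv_of_real)

global_interpretation L1: vector_space scaleL1
  by unfold_locales (transfer, auto simp: L1_rel_def algebra_simps)+


section \<open>The Banach algebra \<open>L(L\<^sub>1)\<close> and its ideals\<close>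

text \<open>The type of bounded operators in HOL-Analysis only asks for linearity over
  \<^typ>\<open>real\<close>, so linearity over the scalar field is imposed separately.
  Over \<^typ>\<open>real\<close> this is no restriction. Norm and topology are those of the operator norm.\<close>

type_synonym 'k L1_map = "'k L1 \<Rightarrow>\<^sub>L 'k L1"

definition L1_ops :: "'k::{real_normed_field, banach, second_countable_topology} L1_map set" where
  "L1_ops = {T :: 'k L1_map. \<forall>c a. T (c *\<^sub>1 a) = c *\<^sub>1 T a}"

lemma bounded_linear_scaleL1:
  "bounded_linear (\<lambda>a. (c::'k::{real_normed_field, banach, second_countable_topology}) *\<^sub>1 a)"
proof (rule bounded_linear_intro[where K = "norm c"])
  show "c *\<^sub>1 r *\<^sub>R a = r *\<^sub>R c *\<^sub>1 a" for r a
    by transfer (simp add: L1_rel_def)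
qed (simp_all add: L1.scale_right_distrib norm_scaleL1 mult.commute)

definition scale_op ::
  "'k \<Rightarrow> 'k L1_map \<Rightarrow> 'k::{real_normed_field, banach, second_countable_topology} L1_map" where
  "scale_op c T = Blinfun (\<lambda>a. c *\<^sub>1 T a)"

lemma scale_op_apply: "scale_op c T a = c *\<^sub>1 T a"
  unfolding scale_op_def
  using bounded_linear_compose[OF bounded_linear_scaleL1 blinfun.bounded_linear_right]
  by (subst bounded_linear_Blinfun_apply) auto

global_interpretation L1_op: vector_space scale_op
  by unfold_locales
    (auto intro!: blinfun_eqI
      simp: scale_op_apply blinfun.add_left L1.scale_right_distrib L1.scale_left_distrib)

definition L1_ideal :: "'k::{real_normed_field, banach, second_countable_topology} L1_map set \<Rightarrow> bool" where
  "L1_ideal I \<longleftrightarrow> I \<subseteq> L1_ops \<and> L1_op.subspace I \<and>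
     (\<forall>T\<in>I. \<forall>A\<in>L1_ops. A o\<^sub>L T \<in> I \<and> T o\<^sub>L A \<in> I)"

definition infinite_dimensional_L1 ::
  "'k::{real_normed_field, banach, second_countable_topology} L1 set \<Rightarrow> bool" where
  "infinite_dimensional_L1 Z \<longleftrightarrow> (\<nexists>B. finite B \<and> Z = L1.span B)"

text \<open>An isomorphism onto its image is a linear homeomorphism onto its image; linearity of the
  inverse is automatic.\<close>

definition strictly_singular :: "'k::{real_normed_field, banach, second_countable_topology} L1_map \<Rightarrow> bool" where
  "strictly_singular T \<longleftrightarrow>
     (\<nexists>Z. L1.subspace Z \<and> closed Z \<and> infinite_dimensional_L1 Z \<and> (\<exists>g. homeomorphism Z (T ` Z) T g))"

definition small_ideal :: "'k::{real_normed_field, banach, second_countable_topology} L1_map set \<Rightarrow> bool" where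
  "small_ideal I \<longleftrightarrow> L1_ideal I \<and> I \<subseteq> {T \<in> L1_ops. strictly_singular T}"

text \<open>Closures are taken in the type of all real-linear bounded operators; this does not matter
  because the scalar-linear operators form a closed subset.\<close>

lemma closed_L1_ops: "closed (L1_ops :: 'k::{real_normed_field, banach, second_countable_topology} L1_map set)"
proof -
  have "continuous_on UNIV (\<lambda>T::'k L1_map. c *\<^sub>1 T a)" for c :: 'k and a :: "'k L1"
    by (intro bounded_linear.continuous_on[OF bounded_linear_scaleL1] continuous_intros)
  then show ?thesis
    unfolding L1_ops_def
    by (intro closed_Collect_all closed_Collect_eq continuous_intros) auto
qed

end

theory Submission
  imports Defs
begin

text \<open>
  Why the theorem holds. The basic operators are the coordinate map of \<open>L\<^sub>1\<close> onto
  \<open>\<ell>\<^sub>1\<close> (integrate over the disjoint sets \<open>[2\<^sup>-\<^sup>j\<^sup>-\<^sup>1, 2\<^sup>-\<^sup>j)\<close>) followed by a map sending the unit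
  vectors of \<open>\<ell>\<^sub>1\<close> to some of the functions of one fixed sequence of Walsh functions. A set \<open>S\<close> of
  indices thus gives an operator \<open>J\<^sub>S\<close> (\<open>block_op\<close>), and the ideals are the algebraic ideals
  generated by the \<open>J\<^sub>S\<close> (\<open>factor_ideal\<close>), that is, the finite sums of products \<open>A J\<^sub>S B\<close>.

  \<^item> Smallness. Walsh functions are orthonormal, so \<open>J\<^sub>S\<close> is dominated by the \<open>\<ell>\<^sub>2\<close> norm of
    the coordinates (\<open>hilbertian\<close>). An operator in the ideal that is bounded below on \<open>Z\<close> would
    therefore make the \<open>\<ell>\<^sub>1\<close> norm and the sup norm of coordinates equivalent on \<open>Z\<close>, which is
    impossible in infinite dimension (\<open>spread_vectors\<close>). Being bounded below on \<open>Z\<close> is stable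
    under small perturbations, so the closure is small too.

  \<^item> The ideals are not closed. A diagonal operator on \<open>\<ell>\<^sub>1\<close> with entries
    \<open>(k+1)\<^sup>-\<^sup>1\<^sup>/\<^sup>4\<close> is a norm limit of finite rank operators, and those lie in the ideal. It is not itself
    in the ideal: a sum of \<open>n\<close> unit vectors with suitable signs has an image of norm at most a
    constant times \<open>n\<^sup>1\<^sup>/\<^sup>2\<close> under an operator dominated by Hilbert space norms, while its
    image under the diagonal operator has norm at least \<open>n\<^sup>3\<^sup>/\<^sup>4\<close>.

  \<^item> The closures are distinct. The Walsh functions come in blocks. Block \<open>k\<close> lives on \<open>N\<^sub>k\<close>
    atoms, and its size \<open>M\<^sub>k\<close> is far larger than \<open>N\<^sub>k\<^sup>2\<^sup>/\<^sup>p\<close> for a certain even \<open>p = p\<^sub>k\<close>, whereas all later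
    blocks together are \<open>p\<close>-wise independent, so that they satisfy a Khinchine inequality in \<open>L\<^sub>p\<close>
    (a \<open>\<Lambda>(p)\<close> property). If \<open>S\<close> omits block \<open>k\<close> and \<open>T = \<Sum> A\<^sub>l J\<^sub>S B\<^sub>l\<close> mapped the unit
    vectors with indices in that block to within \<open>1/2\<close> of its Walsh functions, then testing against
    these functions, Bessel's inequality and the dual form of the Khinchine inequality would give
    \<open>M\<^sub>k \<le> K (R\<^sub>k + c N\<^sub>k\<^sup>2\<^sup>/\<^sup>p)\<close> (\<open>block_obstruction\<close>). Here \<open>R\<^sub>k\<close> is the number of functions in earlier
    blocks, \<open>c\<close> depends on \<open>p\<close> only, and \<open>K\<close> depends on the number of terms of \<open>T\<close> and on the
    norms of the \<open>A\<^sub>l\<close> and \<open>B\<^sub>l\<close>, but not on \<open>k\<close>. Since \<open>M\<^sub>k\<close> is chosen to be at least \<open>k\<close> times the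
    expression in parentheses, the operator of \<open>S'\<close> is not in the closed ideal of \<open>J\<^sub>S\<close> as soon as
    \<open>S'\<close> contains infinitely many blocks that \<open>S\<close> avoids (\<open>block_op_notin_closure\<close>).

  Attaching a rational number to every block, each rational to infinitely many blocks, and letting
  \<open>S\<^sub>p\<close> consist of the blocks whose rational is below \<open>p\<close> gives a family indexed by the reals.
\<close>

section \<open>Walsh functions\<close>

text \<open>The Rademacher function attached to binary digit \<open>i + 1\<close> of \<open>t\<close>. It is given by a formula on the
  whole line so that its values on a dyadic interval can be read off at the left end point.\<close>

definition rad :: "nat \<Rightarrow> real \<Rightarrow> real" where
  "rad i t = (if even \<lfloor>2 ^ Suc i * t\<rfloor> then 1 else - 1)"

definition walsh :: "nat set \<Rightarrow> real \<Rightarrow> real" where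
  "walsh A t = (\<Prod>i\<in>A. rad i t)"

lemma rad_square [simp]: "rad i t * rad i t = 1"
  by (simp add: rad_def)

lemma abs_rad [simp]: "\<bar>rad i t\<bar> = 1"
  by (simp add: rad_def)

lemma abs_walsh [simp]: "\<bar>walsh A t\<bar> = 1"
  by (simp add: walsh_def abs_prod)

lemma walsh_square [simp]: "walsh A t * walsh A t = 1"
  by (simp add: walsh_def prod.distrib[symmetric])

lemma walsh_power2 [simp]: "(walsh A t)\<^sup>2 = 1"
  by (simp add: power2_eq_square)

lemma walsh_empty [simp]: "walsh {} t = 1"
  by (simp add: walsh_def)

lemma walsh_0 [simp]: "walsh A 0 = 1"
  by (simp add: walsh_def rad_def)

lemma walsh_mult:
  assumes "finite A" "finite B"
  shows "walsh A t * walsh B t = walsh (sym_diff A B) t"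
proof -
  have A: "walsh A t = walsh (A - B) t * walsh (A \<inter> B) t"
    unfolding walsh_def using assms by (subst prod.union_disjoint[symmetric]) (auto intro!: prod.cong)
  have B: "walsh B t = walsh (B - A) t * walsh (A \<inter> B) t"
    unfolding walsh_def using assms by (subst prod.union_disjoint[symmetric]) (auto intro!: prod.cong)
  have "walsh (sym_diff A B) t = walsh (A - B) t * walsh (B - A) t"
    unfolding walsh_def by (subst prod.union_disjoint) (auto simp: assms)
  moreover have "walsh (A - B) t * walsh (A \<inter> B) t * (walsh (B - A) t * walsh (A \<inter> B) t)
      = walsh (A - B) t * walsh (B - A) t * (walsh (A \<inter> B) t * walsh (A \<inter> B) t)"
    by (simp only: mult_ac)
  ultimately show ?thesis
    by (simp add: A B)
qed

lemma rad_dyadic: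
  fixes t :: real
  assumes "i < n"
  shows "rad i (of_int \<lfloor>2 ^ n * t\<rfloor> / 2 ^ n) = rad i t"
proof -
  define d where "d = n - Suc i"
  have n: "n = Suc i + d" using assms by (simp add: d_def)
  have *: "\<lfloor>a / 2 ^ d\<rfloor> = \<lfloor>a\<rfloor> div 2 ^ d" for a :: real
    using floor_divide_real_eq_div[of "2 ^ d" a] by simp
  have "\<lfloor>2 ^ Suc i * t\<rfloor> = \<lfloor>2 ^ n * t\<rfloor> div 2 ^ d"
    by (subst *[symmetric]) (simp add: n power_add field_simps)
  moreover have "\<lfloor>2 ^ Suc i * (real_of_int \<lfloor>2 ^ n * t\<rfloor> / 2 ^ n)\<rfloor> = \<lfloor>2 ^ n * t\<rfloor> div 2 ^ d"
  proof -
    have "2 ^ Suc i * (of_int \<lfloor>2 ^ n * t\<rfloor> / 2 ^ n) = (of_int \<lfloor>2 ^ n * t\<rfloor> / 2 ^ d :: real)"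
      by (simp add: n power_add field_simps)
    then show ?thesis by (simp only: *) simp
  qed
  ultimately show ?thesis by (simp add: rad_def)
qed

lemma walsh_dyadic:
  fixes t :: real
  assumes "A \<subseteq> {..<n}"
  shows "walsh A (of_int \<lfloor>2 ^ n * t\<rfloor> / 2 ^ n) = walsh A t"
  unfolding walsh_def using assms by (intro prod.cong) (auto intro: rad_dyadic)

lemma sum_lessThan_double: "(\<Sum>x<2 * m. h x) = (\<Sum>y<m. h (2 * y) + h (Suc (2 * y)))"
  for h :: "nat \<Rightarrow> real"
  by (induction m) (simp_all add: algebra_simps)

text \<open>Passing from the grid of step \<open>2\<^sup>-\<^sup>n\<close> to the next finer one splits every point into two neighbours,
  which agree in all older Rademacher functions and have opposite signs in the newest one.\<close>

lemma sum_walsh_eq_0: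
  assumes "A \<subseteq> {..<n}" "A \<noteq> {}"
  shows "(\<Sum>x<2 ^ n. walsh A (real x / 2 ^ n)) = 0"
  using assms
proof (induction n arbitrary: A)
  case (Suc n)
  have fl: "\<lfloor>2 ^ n * (real z / 2 ^ Suc n)\<rfloor> = int (z div 2)" for z
    using floor_divide_of_nat_eq[of z 2, where 'a = real] by simp
  have coarse: "walsh B (real z / 2 ^ Suc n) = walsh B (real (z div 2) / 2 ^ n)" if "B \<subseteq> {..<n}" for B z
    using walsh_dyadic[OF that, of "real z / 2 ^ Suc n"] by (simp only: fl) simp
  have "(\<Sum>x<2 ^ Suc n. walsh A (real x / 2 ^ Suc n)) =
      (\<Sum>y<2 ^ n. walsh A (real (2 * y) / 2 ^ Suc n) + walsh A (real (Suc (2 * y)) / 2 ^ Suc n))"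
    using sum_lessThan_double[of "\<lambda>x. walsh A (real x / 2 ^ Suc n)" "2 ^ n"] by simp
  also have "\<dots> = 0"
  proof (cases "n \<in> A")
    case True
    define B where "B = A - {n}"
    have B: "B \<subseteq> {..<n}" "n \<notin> B" "A = insert n B" "finite B"
      using True Suc.prems finite_subset[OF Suc.prems(1)] by (auto simp: B_def less_Suc_eq)
    have "walsh A t = rad n t * walsh B t" for t
      using B by (simp add: walsh_def)
    moreover have "rad n (real z / 2 ^ Suc n) = (if even z then 1 else - 1)" for z
      by (simp add: rad_def)
    ultimately have "walsh A (real z / 2 ^ Suc n) = (if even z then 1 else - 1) * walsh B (real (z div 2) / 2 ^ n)" for z
      by (simp only: coarse[OF B(1)])
    then show ?thesis
      by (simp only:) simp
  next
    case False
    then have A: "A \<subseteq> {..<n}" using Suc.prems by (auto simp: less_Suc_eq)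
    have "walsh A (real (2 * y) / 2 ^ Suc n) + walsh A (real (Suc (2 * y)) / 2 ^ Suc n)
        = 2 * walsh A (real y / 2 ^ n)" for y
      by (simp only: coarse[OF A]) simp
    then show ?thesis
      using Suc.IH[OF A Suc.prems(2)] by (simp add: sum_distrib_left[symmetric])
  qed
  finally show ?case .
qed simp

text \<open>The sum of the \<open>v j\<close> in the vector space of subsets over the field with two elements, that is, the
  index set of the product of the corresponding Walsh functions.\<close>

definition xor_family :: "(nat \<Rightarrow> nat set) \<Rightarrow> nat set \<Rightarrow> nat set" where
  "xor_family v F = {n. odd (card {j \<in> F. n \<in> v j})}"

lemma xor_family_empty [simp]: "xor_family v {} = {}"
  by (simp add: xor_family_def)

lemma xor_family_insert:
  assumes "finite F" "j \<notin> F"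
  shows "xor_family v (insert j F) = sym_diff (v j) (xor_family v F)"
proof -
  have "card {i \<in> insert j F. n \<in> v i} = (if n \<in> v j then 1 else 0) + card {i \<in> F. n \<in> v i}" for n
  proof -
    have "{i \<in> insert j F. n \<in> v i} = (if n \<in> v j then insert j {i \<in> F. n \<in> v i} else {i \<in> F. n \<in> v i})"
      by auto
    then show ?thesis using assms by auto
  qed
  then show ?thesis by (auto simp: xor_family_def)
qed

lemma xor_family_subset: "xor_family v F \<subseteq> (\<Union>j\<in>F. v j)"
proof
  fix n assume "n \<in> xor_family v F"
  then have "{j \<in> F. n \<in> v j} \<noteq> {}"
    unfolding xor_family_def by (metis (mono_tags) card.empty even_zero mem_Collect_eq)
  then show "n \<in> (\<Union>j\<in>F. v j)" by auto
qed

lemma prod_walsh: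
  assumes "finite F" "\<And>j. j \<in> F \<Longrightarrow> finite (v j)"
  shows "(\<Prod>j\<in>F. walsh (v j) t) = walsh (xor_family v F) t"
  using assms
proof (induction F rule: finite_induct)
  case (insert j F)
  have "finite (xor_family v F)"
    using insert finite_subset[OF xor_family_subset] by blast
  with insert show ?case
    by (simp add: xor_family_insert walsh_mult)
qed simp

section \<open>Moments of signs with limited independence\<close>

text \<open>Splitting off one sign at a time, an even power of that sign disappears and an odd power
  joins the product over \<open>A\<close>; that product stays nonempty and its length never exceeds \<open>p\<close>, so in
  the end only sums that vanish by independence remain.\<close>

lemma odd_moment_eq_0:
  fixes g :: "'i \<Rightarrow> 'q \<Rightarrow> real" and c :: "'i \<Rightarrow> real"
  assumes sq: "\<And>j q. j \<in> I \<Longrightarrow> q \<in> \<Omega> \<Longrightarrow> (g j q)\<^sup>2 = 1"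
    and indep: "\<And>F. finite F \<Longrightarrow> F \<subseteq> I \<Longrightarrow> F \<noteq> {} \<Longrightarrow> card F \<le> p \<Longrightarrow> (\<Sum>q\<in>\<Omega>. \<Prod>j\<in>F. g j q) = 0"
  assumes "finite F" "F \<subseteq> I" "finite A" "A \<subseteq> I" "A \<inter> F = {}" "A \<noteq> {}" "m + card A \<le> p"
  shows "(\<Sum>q\<in>\<Omega>. (\<Sum>j\<in>F. c j * g j q) ^ m * (\<Prod>j\<in>A. g j q)) = 0"
  using assms(3-)
proof (induction F arbitrary: m A rule: finite_induct)
  case empty
  then show ?case
    using indep[of A] by (cases m) auto
next
  case (insert b F)
  have term0: "(\<Sum>q\<in>\<Omega>. (\<Sum>j\<in>F. c j * g j q) ^ (m - i) * (g b q ^ i * (\<Prod>j\<in>A. g j q))) = 0" if "i \<le> m" for i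
  proof (cases "even i")
    case True
    then have "g b q ^ i = 1" if "q \<in> \<Omega>" for q
      using sq[of b q] that insert.prems by (auto elim!: evenE simp: power_mult)
    then have "(\<Sum>q\<in>\<Omega>. (\<Sum>j\<in>F. c j * g j q) ^ (m - i) * (g b q ^ i * (\<Prod>j\<in>A. g j q)))
        = (\<Sum>q\<in>\<Omega>. (\<Sum>j\<in>F. c j * g j q) ^ (m - i) * (\<Prod>j\<in>A. g j q))"
      by (intro sum.cong) auto
    also have "\<dots> = 0"
      using insert.prems by (intro insert.IH) auto
    finally show ?thesis .
  next
    case False
    then have i: "i > 0" "b \<notin> A" using insert.prems by (auto intro!: Nat.gr0I)
    have "g b q ^ i = g b q" if "q \<in> \<Omega>" for q
      using sq[of b q] that insert.prems False by (auto elim!: oddE simp: power_mult)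
    then have "(\<Sum>q\<in>\<Omega>. (\<Sum>j\<in>F. c j * g j q) ^ (m - i) * (g b q ^ i * (\<Prod>j\<in>A. g j q)))
        = (\<Sum>q\<in>\<Omega>. (\<Sum>j\<in>F. c j * g j q) ^ (m - i) * (\<Prod>j\<in>insert b A. g j q))"
      using i insert.prems by (intro sum.cong) auto
    also have "\<dots> = 0"
      using insert.prems insert.hyps i that by (intro insert.IH) auto
    finally show ?thesis .
  qed
  have "(\<Sum>q\<in>\<Omega>. (\<Sum>j\<in>insert b F. c j * g j q) ^ m * (\<Prod>j\<in>A. g j q))
     = (\<Sum>q\<in>\<Omega>. \<Sum>i\<le>m. of_nat (m choose i) * c b ^ i *
          ((\<Sum>j\<in>F. c j * g j q) ^ (m - i) * (g b q ^ i * (\<Prod>j\<in>A. g j q))))"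
    using insert.hyps
    by (simp add: binomial_ring power_mult_distrib sum_distrib_left sum_distrib_right mult_ac)
  also have "\<dots> = (\<Sum>i\<le>m. of_nat (m choose i) * c b ^ i *
      (\<Sum>q\<in>\<Omega>. (\<Sum>j\<in>F. c j * g j q) ^ (m - i) * (g b q ^ i * (\<Prod>j\<in>A. g j q))))"
    by (subst sum.swap) (simp add: sum_distrib_left)
  also have "\<dots> = 0"
    by (intro sum.neutral) (simp add: term0)
  finally show ?case .
qed

lemma sum_atMost_even:
  fixes a :: "nat \<Rightarrow> real"
  assumes "\<And>i. odd i \<Longrightarrow> a i = 0"
  shows "(\<Sum>i\<le>2 * h. a i) = (\<Sum>i\<le>h. a (2 * i))"
  using assms by (induction h) auto

text \<open>Khinchine's inequality for an even exponent, in which independence up to that order suffices.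
  Adding one sign at a time, odd powers of the new sign contribute nothing by the preceding lemma, so
  that \<open>binomial(2h, 2i) (2(h-i))! = (2h)!/(2i)! \<le> (2h)! binomial(h, i)\<close> recombines the even ones.\<close>

lemma even_moment_le:
  fixes g :: "'i \<Rightarrow> 'q \<Rightarrow> real" and c :: "'i \<Rightarrow> real"
  assumes sq: "\<And>j q. j \<in> I \<Longrightarrow> q \<in> \<Omega> \<Longrightarrow> (g j q)\<^sup>2 = 1"
    and indep: "\<And>F. finite F \<Longrightarrow> F \<subseteq> I \<Longrightarrow> F \<noteq> {} \<Longrightarrow> card F \<le> p \<Longrightarrow> (\<Sum>q\<in>\<Omega>. \<Prod>j\<in>F. g j q) = 0"
  assumes "finite F" "F \<subseteq> I" "2 * h \<le> p"
  shows "(\<Sum>q\<in>\<Omega>. (\<Sum>j\<in>F. c j * g j q) ^ (2 * h)) \<le> real (card \<Omega>) * fact (2 * h) * (\<Sum>j\<in>F. (c j)\<^sup>2) ^ h"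
  using assms(3-)
proof (induction F arbitrary: h rule: finite_induct)
  case empty
  then show ?case by (cases h) auto
next
  case (insert b F)
  define G where "G q = (\<Sum>j\<in>F. c j * g j q)" for q
  define \<sigma> where "\<sigma> = (\<Sum>j\<in>F. (c j)\<^sup>2)"
  have \<sigma>: "\<sigma> \<ge> 0" by (simp add: \<sigma>_def sum_nonneg)
  define a where "a i = real (2 * h choose i) * c b ^ i * (\<Sum>q\<in>\<Omega>. G q ^ (2 * h - i) * g b q ^ i)" for i
  have odd: "a i = 0" if "odd i" for i
  proof (cases "i \<le> 2 * h")
    case True
    have "G q ^ (2 * h - i) * g b q ^ i = G q ^ (2 * h - i) * (\<Prod>j\<in>{b}. g j q)" if "q \<in> \<Omega>" for q
      using sq[of b q] that insert.prems \<open>odd i\<close> by (auto elim!: oddE simp: power_mult)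
    then have "(\<Sum>q\<in>\<Omega>. G q ^ (2 * h - i) * g b q ^ i)
        = (\<Sum>q\<in>\<Omega>. (\<Sum>j\<in>F. c j * g j q) ^ (2 * h - i) * (\<Prod>j\<in>{b}. g j q))"
      unfolding G_def by (intro sum.cong) auto
    also have "\<dots> = 0"
      by (rule odd_moment_eq_0[OF sq indep, where p = p and I = I])
        (use insert.prems insert.hyps True odd_pos[OF that] in auto)
    finally show ?thesis by (simp add: a_def)
  qed (simp add: a_def)
  have even: "a (2 * i) \<le> real (card \<Omega>) * fact (2 * h) * (real (h choose i) * ((c b)\<^sup>2) ^ i * \<sigma> ^ (h - i))" if "i \<le> h" for i
  proof -
    have key: "real (2 * h choose (2 * i)) * fact (2 * (h - i)) \<le> fact (2 * h) * real (h choose i)"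
    proof -
      have "real (2 * h choose (2 * i)) * fact (2 * (h - i)) = fact (2 * h) / fact (2 * i)"
        using that by (simp add: binomial_fact diff_mult_distrib2)
      also have "\<dots> \<le> fact (2 * h) / 1"
        by (intro divide_left_mono) (auto simp: fact_ge_1)
      also have "\<dots> \<le> fact (2 * h) * real (h choose i)"
        using zero_less_binomial[OF that] by (simp add: Suc_leI)
      finally show ?thesis .
    qed
    have "g b q ^ (2 * i) = 1" if "q \<in> \<Omega>" for q
      using sq[of b q] that insert.prems by (simp add: power_mult)
    then have "(\<Sum>q\<in>\<Omega>. G q ^ (2 * h - 2 * i) * g b q ^ (2 * i)) = (\<Sum>q\<in>\<Omega>. G q ^ (2 * (h - i)))"
      by (simp add: diff_mult_distrib2)
    also have "\<dots> \<le> real (card \<Omega>) * fact (2 * (h - i)) * \<sigma> ^ (h - i)"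
      unfolding G_def \<sigma>_def using insert.prems by (intro insert.IH) auto
    finally have "a (2 * i) \<le> real (2 * h choose (2 * i)) * c b ^ (2 * i) * (real (card \<Omega>) * fact (2 * (h - i)) * \<sigma> ^ (h - i))"
      unfolding a_def by (intro mult_left_mono) auto
    also have "\<dots> = real (card \<Omega>) * (real (2 * h choose (2 * i)) * fact (2 * (h - i))) * (((c b)\<^sup>2) ^ i * \<sigma> ^ (h - i))"
      by (simp add: power_mult)
    also have "\<dots> \<le> real (card \<Omega>) * (fact (2 * h) * real (h choose i)) * (((c b)\<^sup>2) ^ i * \<sigma> ^ (h - i))"
      using key \<sigma> by (intro mult_right_mono[OF mult_left_mono]) auto
    finally show ?thesis by (simp add: mult_ac)
  qed
  have "(\<Sum>q\<in>\<Omega>. (\<Sum>j\<in>insert b F. c j * g j q) ^ (2 * h))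
     = (\<Sum>q\<in>\<Omega>. \<Sum>i\<le>2 * h. real (2 * h choose i) * c b ^ i * (G q ^ (2 * h - i) * g b q ^ i))"
    using insert.hyps
    by (simp add: G_def binomial_ring power_mult_distrib mult_ac)
  also have "\<dots> = (\<Sum>i\<le>2 * h. a i)"
    unfolding a_def by (subst sum.swap) (simp add: sum_distrib_left)
  also have "\<dots> = (\<Sum>i\<le>h. a (2 * i))"
    by (rule sum_atMost_even) (rule odd)
  also have "\<dots> \<le> (\<Sum>i\<le>h. real (card \<Omega>) * fact (2 * h) * (real (h choose i) * ((c b)\<^sup>2) ^ i * \<sigma> ^ (h - i)))"
    by (intro sum_mono even) auto
  also have "\<dots> = real (card \<Omega>) * fact (2 * h) * ((c b)\<^sup>2 + \<sigma>) ^ h"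
    by (simp add: binomial_ring sum_distrib_left)
  finally show ?case
    using insert.hyps by (simp add: \<sigma>_def)
qed

text \<open>The dual of a Khinchine inequality of order \<open>2h\<close>. A functional \<open>\<theta>\<close> that is small in two senses,
  uniformly and in total mass, has small Fourier coefficients along the \<open>g j\<close>. Evaluating \<open>\<theta>\<close> on the
  combination \<open>G\<close> whose coefficients are those Fourier coefficients gives their square sum, and on
  the other hand \<open>|G|\<close> is bounded by a threshold \<open>\<alpha>\<close> plus \<open>G\<^sup>2\<^sup>h / \<alpha>\<^sup>2\<^sup>h\<^sup>-\<^sup>1\<close>. The threshold plays
  the part of Hoelder's inequality; the free parameter \<open>\<beta>\<close> avoids fractional powers.\<close>

lemma sum_square_functional_le:
  fixes g :: "'i \<Rightarrow> 'q \<Rightarrow> real"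
  assumes fin: "finite F" "finite \<Omega>" "\<Omega> \<noteq> {}" and h: "h > 0" and \<beta>: "\<beta> > 0" and C: "C \<ge> 0" and K: "K \<ge> 0"
    and moment: "\<And>c. (\<Sum>q\<in>\<Omega>. (\<Sum>j\<in>F. c j * g j q) ^ (2 * h)) \<le> real (card \<Omega>) * K * (\<Sum>j\<in>F. (c j)\<^sup>2) ^ h"
    and \<theta>: "\<And>q. q \<in> \<Omega> \<Longrightarrow> \<bar>\<theta> q\<bar> \<le> C / real (card \<Omega>)" "(\<Sum>q\<in>\<Omega>. \<bar>\<theta> q\<bar>) \<le> \<tau>"
  shows "(\<Sum>j\<in>F. (\<Sum>q\<in>\<Omega>. g j q * \<theta> q)\<^sup>2) \<le> (\<beta> * \<tau> + C * K / \<beta> ^ (2 * h - 1))\<^sup>2"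
proof -
  define c where "c j = (\<Sum>q\<in>\<Omega>. g j q * \<theta> q)" for j
  define s where "s = sqrt (\<Sum>j\<in>F. (c j)\<^sup>2)"
  have s2: "s\<^sup>2 = (\<Sum>j\<in>F. (c j)\<^sup>2)" and s0: "s \<ge> 0"
    by (simp_all add: s_def sum_nonneg)
  have \<Omega>: "real (card \<Omega>) > 0" using fin by (simp add: card_gt_0_iff)
  have "s \<le> \<beta> * \<tau> + C * K / \<beta> ^ (2 * h - 1)" if "s > 0"
  proof -
    define G where "G q = (\<Sum>j\<in>F. c j * g j q)" for q
    \<comment> \<open>scaling the threshold with \<open>s\<close> makes both sides of the final estimate homogeneous in \<open>s\<close>\<close>
    define \<alpha> where "\<alpha> = s * \<beta>"
    have \<alpha>: "\<alpha> > 0" using that \<beta> by (simp add: \<alpha>_def)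
    have G: "\<bar>G q\<bar> \<le> \<alpha> + G q ^ (2 * h) / \<alpha> ^ (2 * h - 1)" for q
    proof (cases "\<bar>G q\<bar> \<le> \<alpha>")
      case True
      have "G q ^ (2 * h) / \<alpha> ^ (2 * h - 1) \<ge> 0" using \<alpha> by (auto simp: power_mult)
      with True show ?thesis by linarith
    next
      case False
      have "\<alpha> ^ (2 * h - 1) * \<bar>G q\<bar> \<le> \<bar>G q\<bar> ^ (2 * h - 1) * \<bar>G q\<bar>"
        using False \<alpha> by (intro mult_right_mono power_mono) auto
      also have "\<dots> = \<bar>G q\<bar> ^ (2 * h)"
        using h by (simp flip: power_Suc2)
      also have "\<dots> = G q ^ (2 * h)" by (simp add: power_even_abs)
      finally have "\<bar>G q\<bar> \<le> G q ^ (2 * h) / \<alpha> ^ (2 * h - 1)"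
        using \<alpha> by (simp add: pos_le_divide_eq mult.commute)
      with \<alpha> show ?thesis by linarith
    qed
    have "s\<^sup>2 = (\<Sum>j\<in>F. c j * (\<Sum>q\<in>\<Omega>. g j q * \<theta> q))"
      unfolding s2 by (simp only: power2_eq_square flip: c_def)
    also have "\<dots> = (\<Sum>q\<in>\<Omega>. G q * \<theta> q)"
      unfolding G_def by (simp add: sum_distrib_left sum_distrib_right mult.assoc) (rule sum.swap)
    also have "\<dots> \<le> (\<Sum>q\<in>\<Omega>. \<bar>G q\<bar> * \<bar>\<theta> q\<bar>)"
      by (intro sum_mono) (metis abs_ge_self abs_mult)
    also have "\<dots> \<le> (\<Sum>q\<in>\<Omega>. \<alpha> * \<bar>\<theta> q\<bar> + G q ^ (2 * h) / \<alpha> ^ (2 * h - 1) * (C / real (card \<Omega>)))"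
    proof (intro sum_mono)
      fix q assume q: "q \<in> \<Omega>"
      have "\<bar>G q\<bar> * \<bar>\<theta> q\<bar> \<le> (\<alpha> + G q ^ (2 * h) / \<alpha> ^ (2 * h - 1)) * \<bar>\<theta> q\<bar>"
        using G by (intro mult_right_mono) auto
      moreover have "G q ^ (2 * h) / \<alpha> ^ (2 * h - 1) * \<bar>\<theta> q\<bar> \<le> G q ^ (2 * h) / \<alpha> ^ (2 * h - 1) * (C / real (card \<Omega>))"
        using \<theta>(1)[OF q] \<alpha> by (intro mult_left_mono) (auto simp: power_mult)
      ultimately show "\<bar>G q\<bar> * \<bar>\<theta> q\<bar> \<le> \<alpha> * \<bar>\<theta> q\<bar> + G q ^ (2 * h) / \<alpha> ^ (2 * h - 1) * (C / real (card \<Omega>))"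
        by (simp add: algebra_simps)
    qed
    also have "\<dots> = \<alpha> * (\<Sum>q\<in>\<Omega>. \<bar>\<theta> q\<bar>) + (\<Sum>q\<in>\<Omega>. G q ^ (2 * h)) * (C / real (card \<Omega>) / \<alpha> ^ (2 * h - 1))"
      by (simp add: sum.distrib sum_distrib_left sum_distrib_right mult_ac divide_inverse)
    also have "\<dots> \<le> \<alpha> * \<tau> + (real (card \<Omega>) * K * (s\<^sup>2) ^ h) * (C / real (card \<Omega>) / \<alpha> ^ (2 * h - 1))"
      using \<theta>(2) \<alpha> C moment[of c] by (intro add_mono mult_left_mono mult_right_mono) (auto simp: G_def s2)
    also have "\<dots> = s * (\<beta> * \<tau> + C * K / \<beta> ^ (2 * h - 1))"
    proof -
      have "(s\<^sup>2) ^ h = s ^ (2 * h - 1) * s"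
        using h by (simp flip: power_Suc2 power_mult)
      then show ?thesis
        using \<Omega> that \<beta> by (simp add: \<alpha>_def power_mult_distrib field_simps)
    qed
    finally show ?thesis
      using that by (simp add: power2_eq_square)
  qed
  moreover have "0 \<le> \<beta> * \<tau> + C * K / \<beta> ^ (2 * h - 1)"
  proof -
    have "\<tau> \<ge> 0" using \<theta>(2) by (meson abs_ge_zero order_trans sum_nonneg)
    then show ?thesis using \<beta> C K by simp
  qed
  ultimately have "s \<le> \<beta> * \<tau> + C * K / \<beta> ^ (2 * h - 1)"
    using s0 by force
  then have "s\<^sup>2 \<le> (\<beta> * \<tau> + C * K / \<beta> ^ (2 * h - 1))\<^sup>2"
    using s0 by (intro power_mono) auto
  then show ?thesis by (simp add: s2 c_def)
qed

section \<open>Blocks of Walsh functions\<close>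

text \<open>A set of at most \<open>s\<close> numbers below \<open>j\<close> is the range of a function from an \<open>s\<close>-element set into
  \<open>{..j}\<close>, the value \<open>j\<close> serving as padding.\<close>

lemma card_bounded_subsets_le:
  "card (f ` {F. F \<subseteq> {..<j} \<and> card F \<le> s}) \<le> (j + 1) ^ s"
proof -
  have "f ` {F. F \<subseteq> {..<j} \<and> card F \<le> s} \<subseteq> (\<lambda>g. f (g ` {..<s} \<inter> {..<j})) ` ({..<s} \<rightarrow>\<^sub>E {..j})"
  proof clarify
    fix F assume F: "F \<subseteq> {..<j}" "card F \<le> s"
    have fin: "finite F" using F finite_subset by blast
    obtain b where b: "bij_betw b {..<card F} F"
      using ex_bij_betw_nat_finite[OF fin] by (auto simp: atLeast0LessThan)
    define g where "g = (\<lambda>i\<in>{..<s}. if i < card F then b i else j)"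
    have b_in: "b i \<in> F" if "i < card F" for i
      using b that by (auto simp: bij_betw_def)
    have "g \<in> {..<s} \<rightarrow>\<^sub>E {..j}"
      using F b_in by (force simp: g_def)
    moreover have "g ` {..<s} \<inter> {..<j} = F"
    proof
      show "g ` {..<s} \<inter> {..<j} \<subseteq> F"
        using b_in by (auto simp: g_def split: if_splits)
      show "F \<subseteq> g ` {..<s} \<inter> {..<j}"
      proof
        fix y assume y: "y \<in> F"
        then obtain i where "i < card F" "y = b i"
          using b by (auto simp: bij_betw_def)
        then have "g i = y" "i < s" using F by (auto simp: g_def)
        then show "y \<in> g ` {..<s} \<inter> {..<j}" using y F by force
      qed
    qed
    ultimately show "f F \<in> (\<lambda>g. f (g ` {..<s} \<inter> {..<j})) ` ({..<s} \<rightarrow>\<^sub>E {..j})"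
      by (metis (no_types, lifting) imageI)
  qed
  then have "card (f ` {F. F \<subseteq> {..<j} \<and> card F \<le> s}) \<le> card ((\<lambda>g. f (g ` {..<s} \<inter> {..<j})) ` ({..<s} \<rightarrow>\<^sub>E {..j}))"
    by (intro card_mono finite_imageI finite_PiE) auto
  also have "\<dots> \<le> card ({..<s} \<rightarrow>\<^sub>E {..j})"
    by (intro card_image_le finite_PiE) auto
  also have "\<dots> = (j + 1) ^ s"
    by (simp add: card_PiE)
  finally show ?thesis .
qed

lemma xor_family_cong:
  assumes "\<And>j. j \<in> F \<Longrightarrow> v j = w j"
  shows "xor_family v F = xor_family w F"
  using assms unfolding xor_family_def by (metis (mono_tags, lifting) Collect_cong)

text \<open>At step \<open>j\<close> there are more candidates than sums of few earlier sets, so a fresh one can be chosen.\<close>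

lemma greedy_xor_sequence:
  assumes "\<And>j. (j + 1) ^ s j < 2 ^ n j"
  obtains v :: "nat \<Rightarrow> nat set" where "\<And>j. v j \<subseteq> {..<n j}"
    "\<And>j F. F \<subseteq> {..<j} \<Longrightarrow> card F \<le> s j \<Longrightarrow> v j \<noteq> xor_family v F"
proof -
  define P where "P v j A \<longleftrightarrow> A \<subseteq> {..<n j} \<and> A \<notin> xor_family v ` {F. F \<subseteq> {..<j} \<and> card F \<le> s j}" for v j A
  have "\<exists>v. \<forall>j. P v j (v j)"
  proof (rule dependent_wf_choice[of "{(i, j :: nat). i < j}"])
    show "wf {(i, j :: nat). i < j}" by (rule wf_less)
    show "P f x r = P g x r" if "\<And>z. (z, x) \<in> {(i, j). i < j} \<Longrightarrow> f z = g z" for f g x r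
    proof -
      have "xor_family f F = xor_family g F" if "F \<subseteq> {..<x}" for F
        using that \<open>\<And>z. (z, x) \<in> {(i, j). i < j} \<Longrightarrow> f z = g z\<close> by (intro xor_family_cong) auto
      then show ?thesis unfolding P_def by (auto simp: image_iff)
    qed
    show "\<exists>r. P f j r" for j f
    proof (rule ccontr)
      assume "\<nexists>r. P f j r"
      then have "Pow {..<n j} \<subseteq> xor_family f ` {F. F \<subseteq> {..<j} \<and> card F \<le> s j}"
        unfolding P_def by auto
      moreover have "finite {F. F \<subseteq> {..<j} \<and> card F \<le> s j}"
        by (rule finite_subset[of _ "Pow {..<j}"]) auto
      ultimately have "card (Pow {..<n j}) \<le> card (xor_family f ` {F. F \<subseteq> {..<j} \<and> card F \<le> s j})"
        by (intro card_mono) auto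
      also have "\<dots> \<le> (j + 1) ^ s j" by (rule card_bounded_subsets_le)
      also have "\<dots> < 2 ^ n j" by (rule assms)
      finally show False by (simp add: card_Pow)
    qed
  qed
  then obtain v where "\<And>j. P v j (v j)" by blast
  then show ?thesis
    by (intro that[of v]) (auto simp: P_def)
qed

text \<open>The indices \<open>R k, \<dots>, R (k+1) - 1\<close> form block \<open>k\<close>; the Walsh functions \<open>walsh (v j)\<close> of that block
  are constant on the \<open>N = 2 ^ n k\<close> dyadic intervals of level \<open>n k\<close>. All later blocks together are
  independent up to order \<open>p = 2 h\<close>. The number \<open>\<beta> = N\<^sup>1\<^sup>/\<^sup>p\<close> is carried along as an integer, so that the
  last condition says that block \<open>k\<close> is much larger than the number of functions before
  it and than \<open>N\<^sup>2\<^sup>/\<^sup>p\<close>; the factor \<open>k + 1\<close> eventually beats every constant.\<close>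

locale walsh_blocks =
  fixes v :: "nat \<Rightarrow> nat set" and R n h \<beta> :: "nat \<Rightarrow> nat"
  assumes finite_v: "finite (v j)"
    and inj_v: "inj v"
    and block_support: "R k \<le> j \<Longrightarrow> j < R (Suc k) \<Longrightarrow> v j \<subseteq> {..<n k}"
    and independent: "finite F \<Longrightarrow> F \<subseteq> {R (Suc k)..} \<Longrightarrow> F \<noteq> {} \<Longrightarrow> card F \<le> 2 * h k \<Longrightarrow> xor_family v F \<noteq> {}"
    and h_pos: "h k > 0"
    and grid: "2 ^ n k = \<beta> k ^ (2 * h k)"
    and large: "(k + 1) * (R k + 1 + (1 + fact (2 * h k))\<^sup>2 * (\<beta> k)\<^sup>2) + R k \<le> R (Suc k)"

text \<open>Block \<open>k\<close> is chosen independent up to order \<open>s k = 2 \<cdot> 4\<^sup>k\<close>, while it has to be large in comparison with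
  \<open>N\<^sup>2\<^sup>/\<^sup>p\<close> for \<open>p = s (k + 1) = 4 s k\<close>. With \<open>N = \<beta>\<^sup>p\<close> and \<open>\<beta>\<^sup>3\<close> functions up to the end of the block there is
  room for both: the greedy choice needs \<open>\<beta>\<^sup>3\<^sup>s < N = \<beta>\<^sup>4\<^sup>s\<close>, and the size \<open>\<beta>\<^sup>3 - R k\<close> of the block
  exceeds any fixed multiple of \<open>\<beta>\<^sup>2\<close> once \<open>\<beta> = 2\<^sup>r\<close> is large.\<close>

lemma walsh_blocks_exist: "\<exists>v R n h \<beta>. walsh_blocks v R n h \<beta>"
proof -
  define s :: "nat \<Rightarrow> nat" where "s k = 2 * 4 ^ k" for k
  define h :: "nat \<Rightarrow> nat" where "h k = 4 ^ Suc k" for k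
  have sh: "s (Suc k) = 2 * h k" "4 * s k = 2 * h k" for k
    by (simp_all add: s_def h_def)
  define big where "big k x r \<longleftrightarrow>
    (k + 1) * (x + 1 + (1 + fact (2 * h k))\<^sup>2 * (2 ^ r)\<^sup>2) + x \<le> 2 ^ (3 * r)" for k x r :: nat
  define \<rho> where "\<rho> k x = (SOME r. big k x r)" for k x
  have big: "big k x (\<rho> k x)" for k x
    unfolding \<rho>_def
  proof (rule someI)
    define a b :: nat where "a = (k + 1) * (x + 1) + x" and "b = (k + 1) * (1 + fact (2 * h k))\<^sup>2"
    have "a + b * 4 ^ (a + b) \<le> a * 4 ^ (a + b) + b * 4 ^ (a + b)"
      by (intro add_right_mono) simp
    also have "\<dots> = (a + b) * 4 ^ (a + b)" by (simp add: algebra_simps)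
    also have "\<dots> \<le> 2 ^ (a + b) * 4 ^ (a + b)"
      using less_exp[of "a + b"] by (intro mult_right_mono) auto
    also have "\<dots> = 2 ^ (3 * (a + b))"
      by (simp only: power_mult flip: power_mult_distrib) simp
    finally have "a + b * 4 ^ (a + b) \<le> 2 ^ (3 * (a + b))" .
    moreover have "((2::nat) ^ (a + b))\<^sup>2 = 4 ^ (a + b)"
      by (simp add: power2_eq_square flip: power_mult_distrib)
    ultimately show "big k x (a + b)"
      unfolding big_def by (simp only:) (simp add: a_def b_def algebra_simps)
  qed
  define R where "R = rec_nat 0 (\<lambda>k x. 2 ^ (3 * \<rho> k x) :: nat)"
  define r where "r k = \<rho> k (R k)" for k
  have R_Suc: "R (Suc k) = 2 ^ (3 * r k)" for k
    by (simp add: R_def r_def)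
  have large: "(k + 1) * (R k + 1 + (1 + fact (2 * h k))\<^sup>2 * (2 ^ r k)\<^sup>2) + R k \<le> R (Suc k)" for k
    using big[of k "R k"] unfolding R_Suc by (simp add: big_def r_def)
  have "R k < R (Suc k)" for k
  proof -
    have "1 + R k \<le> (k + 1) * (R k + 1 + (1 + fact (2 * h k))\<^sup>2 * (2 ^ r k)\<^sup>2) + R k"
      by simp
    with large[of k] show ?thesis by linarith
  qed
  then have R: "strict_mono R" by (simp add: strict_mono_Suc_iff)
  have r_pos: "r k > 0" for k
  proof (rule ccontr)
    assume "\<not> r k > 0"
    then have "R (Suc k) = 1" by (simp add: R_Suc)
    moreover have "2 \<le> (k + 1) * (R k + 1 + (1 + fact (2 * h k))\<^sup>2 * (2 ^ r k)\<^sup>2)"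
    proof -
      have "1 * 2 \<le> (k + 1) * (R k + 1 + (1 + fact (2 * h k))\<^sup>2 * (2 ^ r k)\<^sup>2)"
        by (intro mult_mono) (auto simp: Suc_le_eq)
      then show ?thesis by simp
    qed
    ultimately show False using large[of k] by linarith
  qed
  define b where "b j = (LEAST k. j < R (Suc k))" for j
  have less_b: "j < R (Suc (b j))" for j
    unfolding b_def
  proof (rule LeastI)
    show "j < R (Suc j)" using strict_mono_imp_increasing[OF R, of "Suc j"] by linarith
  qed
  have b_ge: "b j \<ge> k" if "R k \<le> j" for j k
  proof (rule ccontr)
    assume "\<not> b j \<ge> k"
    then have "R (Suc (b j)) \<le> R k" using strict_mono_less_eq[OF R] by simp
    with less_b[of j] that show False by linarith
  qed
  have b_eq: "b j = k" if "R k \<le> j" "j < R (Suc k)" for j k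
    using b_ge[OF that(1)] Least_le[of "\<lambda>k. j < R (Suc k)", OF that(2)] by (simp add: b_def)
  define n where "n k = r k * (2 * h k)" for k
  have "(j + 1) ^ s (b j) < 2 ^ n (b j)" for j
  proof -
    have "(j + 1) ^ s (b j) \<le> (2 ^ (3 * r (b j))) ^ s (b j)"
      using less_b[of j] by (intro power_mono) (auto simp: R_Suc)
    also have "\<dots> < 2 ^ n (b j)"
      using r_pos[of "b j"] by (simp add: n_def flip: power_mult sh(2)) (simp add: s_def)
    finally show ?thesis .
  qed
  then obtain v where v: "\<And>j. v j \<subseteq> {..<n (b j)}"
    "\<And>j F. F \<subseteq> {..<j} \<Longrightarrow> card F \<le> s (b j) \<Longrightarrow> v j \<noteq> xor_family v F"
    using greedy_xor_sequence[of "\<lambda>j. s (b j)" "\<lambda>j. n (b j)"] by blast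
  have fin: "finite (v j)" for j using v(1) finite_subset by blast
  have "walsh_blocks v R n h (\<lambda>k. 2 ^ r k)"
  proof
    show "inj v"
    proof (rule linorder_injI)
      fix i j :: nat assume "i < j"
      then show "v i \<noteq> v j"
        using v(2)[of "{i}" j] xor_family_insert[of "{}" i v] by (auto simp: s_def)
    qed
    show "v j \<subseteq> {..<n k}" if "R k \<le> j" "j < R (Suc k)" for j k
      using v(1)[of j] b_eq[OF that] by simp
    show "xor_family v F \<noteq> {}" if F: "finite F" "F \<subseteq> {R (Suc k)..}" "F \<noteq> {}" "card F \<le> 2 * h k" for F k
    proof
      \<comment> \<open>then the set with the largest index is the sum of the others, which the greedy choice excludes\<close>
      assume x: "xor_family v F = {}"
      define j where "j = Max F"
      have j: "j \<in> F" using F by (simp add: j_def)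
      then have "Suc k \<le> b j" using F by (intro b_ge) auto
      then have "s (Suc k) \<le> s (b j)" by (simp add: s_def del: power_Suc)
      moreover have "F - {j} \<subseteq> {..<j}"
        using F by (auto simp: j_def order.not_eq_order_implies_strict)
      moreover have "card (F - {j}) \<le> card F" using F by (intro card_mono) auto
      ultimately have "v j \<noteq> xor_family v (F - {j})"
        using F(4) sh(1)[of k] by (intro v(2)) auto
      moreover have "xor_family v F = sym_diff (v j) (xor_family v (F - {j}))"
        using xor_family_insert[of "F - {j}" j v] F j by (simp add: insert_absorb)
      ultimately show False using x by blast
    qed
    show "2 ^ n k = ((2 :: nat) ^ r k) ^ (2 * h k)" for k
      by (simp add: n_def power_mult)
  qed (use fin large in \<open>auto simp: h_def\<close>)
  then show ?thesis by blast
qed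

section \<open>Dyadic intervals and integration\<close>

definition dyad :: "nat \<Rightarrow> nat \<Rightarrow> real set" where
  "dyad n x = {t \<in> {0<..<1}. \<lfloor>2 ^ n * t\<rfloor> = int x}"

lemma dyad_disjoint: "x \<noteq> y \<Longrightarrow> dyad n x \<inter> dyad n y = {}"
  by (auto simp: dyad_def)

lemma dyad_cover:
  assumes "t \<in> {0<..<1}"
  shows "nat \<lfloor>2 ^ n * t\<rfloor> < 2 ^ n" "t \<in> dyad n (nat \<lfloor>2 ^ n * t\<rfloor>)"
proof -
  have "2 ^ n * t < 2 ^ n" "0 \<le> 2 ^ n * t" using assms by auto
  then have "\<lfloor>2 ^ n * t\<rfloor> < 2 ^ n" "0 \<le> \<lfloor>2 ^ n * t\<rfloor>" by (auto simp: floor_less_iff)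
  then show "nat \<lfloor>2 ^ n * t\<rfloor> < 2 ^ n" "t \<in> dyad n (nat \<lfloor>2 ^ n * t\<rfloor>)"
    using assms by (auto simp: dyad_def nat_less_iff)
qed

lemma dyad_eq: "dyad n x = {real x / 2 ^ n..<(real x + 1) / 2 ^ n} \<inter> {0<..<1}"
  by (auto simp: dyad_def floor_eq_iff field_simps)

lemma sets_dyad [measurable, simp]: "dyad n x \<in> sets leb01"
  unfolding dyad_eq by (auto simp: sets_restrict_space)

lemma measure_dyad:
  assumes "x < 2 ^ n"
  shows "measure leb01 (dyad n x) = 1 / 2 ^ n"
proof -
  have le: "(real x + 1) / 2 ^ n \<le> 1"
  proof -
    have "real x + 1 \<le> 2 ^ n"
      using assms by (metis of_nat_Suc Suc_leI of_nat_le_iff of_nat_numeral of_nat_power add.commute)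
    then show ?thesis by simp
  qed
  have "measure leb01 (dyad n x) = measure lebesgue (dyad n x)"
    by (subst measure_restrict_space) (auto simp: dyad_eq)
  also have "\<dots> = measure lebesgue {real x / 2 ^ n..<(real x + 1) / 2 ^ n}"
  proof -
    have "dyad n x = {real x / 2 ^ n..<(real x + 1) / 2 ^ n} - {0}"
    proof -
      have "{a..<b} \<inter> {0<..<1} = {a..<b} - {0}" if "0 \<le> a" "b \<le> 1" for a b :: real
        using that by auto
      then show ?thesis using le by (simp add: dyad_eq)
    qed
    then show ?thesis
      by (metis measure_Diff_null_set null_setsI lmeasurable_iff_integrable negligible_iff_null_sets
          negligible_sing fmeasurableD lmeasurable_interval(2) sets.Diff sets_completionI_sets
          atLeastLessThan_borel sets_lborel)
  qed
  also have "\<dots> = 1 / 2 ^ n"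
    by (simp add: field_simps)
  finally show ?thesis .
qed

lemma finite_leb01: "finite_measure leb01"
  by (intro finite_measure_lebesgue_on) simp

interpretation leb01: finite_measure leb01
  by (rule finite_leb01)

lemma measure_leb01 [simp]: "measure leb01 {0<..<1} = 1"
  by (subst measure_restrict_space) auto

lemma integrable_dyad:
  fixes f :: "real \<Rightarrow> 'k::{real_normed_field, banach, second_countable_topology}"
  assumes "integrable leb01 f"
  shows "integrable leb01 (\<lambda>t. indicator (dyad n x) t *\<^sub>R f t)"
  using assms by (intro integrable_mult_indicator) auto

lift_definition dyint :: "nat \<Rightarrow> nat \<Rightarrow> 'k::{real_normed_field, banach, second_countable_topology} L1 \<Rightarrow> 'k"
  is "\<lambda>n x f. LINT t|leb01. indicator (dyad n x) t *\<^sub>R f t"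
  by (intro integral_cong_AE) (auto simp: L1_rel_def intro!: borel_measurable_integrable integrable_dyad)

lift_definition atom :: "nat \<Rightarrow> nat \<Rightarrow> 'k::{real_normed_field, banach, second_countable_topology} L1"
  is "\<lambda>n x t. of_real (indicator (dyad n x) t)"
  by (auto simp: L1_rel_def intro!: integrable_of_real leb01.integrable_const_bound[where B = 1])

lemma integrable_indicator_leb01 [simp]:
  "A \<in> sets leb01 \<Longrightarrow> integrable leb01 (indicat_real A)"
  by (auto intro!: leb01.integrable_const_bound[where B = 1])

lemma dyint_add: "dyint n x (f + g) = dyint n x f + dyint n x g"
  by transfer (simp add: L1_rel_def scaleR_add_right integrable_dyad)

lemma dyint_scaleL1: "dyint n x (c *\<^sub>1 f) = c * dyint n x f"
  by transfer (simp add: L1_rel_def integrable_dyad flip: mult_scaleR_right)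

lemma dyint_scaleR: "dyint n x (r *\<^sub>R f) = r *\<^sub>R dyint n x f"
  by (simp add: scaleR_L1_eq dyint_scaleL1 scaleR_conv_of_real)

lemma sum_norm_dyint_le:
  fixes f :: "'k::{real_normed_field, banach, second_countable_topology} L1"
  assumes "finite I" "disjoint_family_on (\<lambda>i. dyad (n i) (x i)) I"
  shows "(\<Sum>i\<in>I. norm (dyint (n i) (x i) f)) \<le> norm f"
  using assms
proof transfer
  fix I and n x :: "'b \<Rightarrow> nat" and f :: "real \<Rightarrow> 'k"
  assume I: "finite I" "disjoint_family_on (\<lambda>i. dyad (n i) (x i)) I" and "L1_rel f f"
  then have f: "integrable leb01 f" by (simp add: L1_rel_def)
  have "(\<Sum>i\<in>I. norm (LINT t|leb01. indicator (dyad (n i) (x i)) t *\<^sub>R f t))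
      \<le> (\<Sum>i\<in>I. (LINT t|leb01. norm (indicator (dyad (n i) (x i)) t *\<^sub>R f t)))"
    by (intro sum_mono integral_norm_bound)
  also have "\<dots> = (LINT t|leb01. (\<Sum>i\<in>I. norm (indicator (dyad (n i) (x i)) t *\<^sub>R f t)))"
    by (subst Bochner_Integration.integral_sum) (auto intro!: integrable_norm integrable_dyad f simp del: norm_scaleR)
  also have "\<dots> \<le> (LINT t|leb01. norm (f t))"
  proof (intro integral_mono integrable_norm f Bochner_Integration.integrable_sum integrable_dyad)
    fix t
    have "(\<Sum>i\<in>I. indicat_real (dyad (n i) (x i)) t) = indicator (\<Union>i\<in>I. dyad (n i) (x i)) t"
      using I by (simp add: indicator_UN_disjoint)
    then have "(\<Sum>i\<in>I. indicat_real (dyad (n i) (x i)) t) \<le> 1"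
      by (simp add: indicator_def)
    then have "(\<Sum>i\<in>I. indicat_real (dyad (n i) (x i)) t) * norm (f t) \<le> 1 * norm (f t)"
      by (intro mult_right_mono) auto
    then show "(\<Sum>i\<in>I. norm (indicator (dyad (n i) (x i)) t *\<^sub>R f t)) \<le> norm (f t)"
      by (simp add: sum_distrib_right)
  qed
  finally show "(\<Sum>i\<in>I. norm (LINT t|leb01. indicator (dyad (n i) (x i)) t *\<^sub>R f t)) \<le> (LINT t|leb01. norm (f t))" .
qed

lemma bounded_linear_dyint: "bounded_linear (dyint n x)"
proof (rule bounded_linear_intro[where K = 1])
  show "norm (dyint n x f) \<le> norm f * 1" for f :: "'a L1"
    using sum_norm_dyint_le[of "{()}" "\<lambda>_. n" "\<lambda>_. x" f] by (simp add: disjoint_family_on_def)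
qed (simp_all add: dyint_add dyint_scaleR)

lemma dyint_sum: "dyint n x (\<Sum>i\<in>I. f i) = (\<Sum>i\<in>I. dyint n x (f i))"
  by (rule linear_sum[OF bounded_linear.linear[OF bounded_linear_dyint]])

lemma dyint_diff: "dyint n x (f - g) = dyint n x f - dyint n x g"
  by (rule linear_diff[OF bounded_linear.linear[OF bounded_linear_dyint]])

lemma sum_norm_dyint_grid_le: "(\<Sum>x<2 ^ n. norm (dyint n x f)) \<le> norm f"
  using sum_norm_dyint_le[of "{..<2 ^ n}" "\<lambda>_. n" "\<lambda>x. x" f]
  by (simp add: disjoint_family_on_def dyad_disjoint)

lemma dyint_atom: "dyint n x (atom m y) = of_real (measure leb01 (dyad n x \<inter> dyad m y))"
proof transfer
  fix n x m y
  have "(LINT t|leb01. indicator (dyad n x) t *\<^sub>R of_real (indicator (dyad m y) t))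
      = (LINT t|leb01. of_real (indicator (dyad n x \<inter> dyad m y) t) :: 'a)"
    by (intro Bochner_Integration.integral_cong) (auto simp: indicator_def)
  also have "\<dots> = of_real (LINT t|leb01. indicator (dyad n x \<inter> dyad m y) t)"
    by (rule integral_of_real) simp
  also have "\<dots> = of_real (measure leb01 (dyad n x \<inter> dyad m y))"
    by (simp add: dyad_def space_restrict_space Int_absorb2 subset_iff)
  finally show "(LINT t|leb01. indicator (dyad n x) t *\<^sub>R of_real (indicator (dyad m y) t))
      = (of_real (measure leb01 (dyad n x \<inter> dyad m y)) :: 'a)" .
qed

lemma dyint_atom_grid:
  assumes "x < 2 ^ n"
  shows "dyint n x (atom n y) = (if x = y then of_real (1 / 2 ^ n) else 0)"
  using assms by (simp add: dyint_atom dyad_disjoint measure_dyad del: of_real_divide)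

lemma norm_atom:
  assumes "x < 2 ^ n"
  shows "norm (atom n x :: 'k::{real_normed_field, banach, second_countable_topology} L1) = 1 / 2 ^ n"
proof -
  have "norm (atom n x :: 'k L1) = (LINT t|leb01. indicator (dyad n x) t)"
    by transfer (simp add: abs_of_nonneg)
  also have "\<dots> = 1 / 2 ^ n"
    using measure_dyad[OF assms] by (simp add: dyad_def space_restrict_space Int_absorb2 subset_iff)
  finally show ?thesis .
qed

lemma borel_measurable_walsh [measurable]: "walsh A \<in> borel_measurable borel"
proof -
  have "rad i \<in> borel_measurable borel" for i
    unfolding rad_def by measurable
  then show ?thesis unfolding walsh_def[abs_def] by measurable
qed

lemma L1_rel_walsh:
  "L1_rel (\<lambda>t. of_real (walsh A t)) (\<lambda>t. of_real (walsh A t) :: 'k::{real_normed_field, banach, second_countable_topology})"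
proof -
  have "walsh A \<in> borel_measurable leb01"
    by (intro measurable_restrict_space1 measurable_completion) simp
  then show ?thesis
    by (auto simp: L1_rel_def intro!: integrable_of_real leb01.integrable_const_bound[where B = 1])
qed

lift_definition wal :: "nat set \<Rightarrow> 'k::{real_normed_field, banach, second_countable_topology} L1"
  is "\<lambda>A t. of_real (walsh A t)"
  by (rule L1_rel_walsh)

lemma norm_wal: "norm (wal A) = 1"
  by transfer (simp add: space_restrict_space)

text \<open>Integrability of the representative is part of the same induction, because adding two classes by
  adding representatives presupposes it.\<close>

lemma abs_L1_sum_atoms:
  fixes c :: "nat \<Rightarrow> real"
  assumes "finite X"
  shows "L1_rel (\<lambda>t. \<Sum>x\<in>X. of_real (c x * indicator (dyad n x) t) :: 'k::{real_normed_field, banach, second_countable_topology}) (\<lambda>t. \<Sum>x\<in>X. of_real (c x * indicator (dyad n x) t) :: 'k::{real_normed_field, banach, second_countable_topology}) \<and>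
    (\<Sum>x\<in>X. c x *\<^sub>R atom n x) = abs_L1 (\<lambda>t. \<Sum>x\<in>X. of_real (c x * indicator (dyad n x) t) :: 'k::{real_normed_field, banach, second_countable_topology})"
  using assms
proof (induction X rule: finite_induct)
  case empty
  show ?case by (simp add: L1_rel_def zero_L1_def)
next
  case (insert x X)
  have 1: "L1_rel (\<lambda>t. of_real (c x * indicator (dyad n x) t)) (\<lambda>t. of_real (c x * indicator (dyad n x) t) :: 'k)"
    by (auto simp: L1_rel_def intro!: integrable_of_real integrable_mult_right leb01.integrable_const_bound[where B = 1]
        simp del: of_real_mult)
  have "c x *\<^sub>R atom n x = abs_L1 (\<lambda>t. of_real (c x * indicator (dyad n x) t) :: 'k)"
    unfolding atom_def map_fun_apply id_apply
    by (subst scaleR_L1.abs_eq)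
      (auto simp: L1_rel_def scaleR_conv_of_real intro!: integrable_of_real leb01.integrable_const_bound[where B = 1])
  with insert.IH have "(\<Sum>x\<in>insert x X. c x *\<^sub>R atom n x) =
      abs_L1 (\<lambda>t. of_real (c x * indicator (dyad n x) t)) + abs_L1 (\<lambda>t. \<Sum>x\<in>X. of_real (c x * indicator (dyad n x) t) :: 'k)"
    using insert.hyps by simp
  also have "\<dots> = abs_L1 (\<lambda>t. of_real (c x * indicator (dyad n x) t) + (\<Sum>x\<in>X. of_real (c x * indicator (dyad n x) t)))"
    using 1 insert.IH by (intro plus_L1.abs_eq) auto
  finally show ?case
    using 1 insert.IH insert.hyps by (auto simp: L1_rel_def)
qed

lemma wal_eq_sum_atoms:
  assumes "A \<subseteq> {..<n}"
  shows "wal A = (\<Sum>x<2 ^ n. walsh A (real x / 2 ^ n) *\<^sub>R atom n x :: 'k::{real_normed_field, banach, second_countable_topology} L1)"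
proof -
  let ?g = "\<lambda>t. \<Sum>x<2 ^ n. of_real (walsh A (real x / 2 ^ n) * indicator (dyad n x) t) :: 'k"
  have g: "L1_rel ?g ?g" "(\<Sum>x<2 ^ n. walsh A (real x / 2 ^ n) *\<^sub>R atom n x) = abs_L1 ?g"
    using abs_L1_sum_atoms[of "{..<2 ^ n}" "\<lambda>x. walsh A (real x / 2 ^ n)" n, where 'k = 'k] by auto
  have eq: "of_real (walsh A t) = ?g t" if "t \<in> {0<..<1}" for t
  proof -
    define y where "y = nat \<lfloor>2 ^ n * t\<rfloor>"
    note y = dyad_cover[OF that, of n, folded y_def]
    have "?g t = (\<Sum>x<2 ^ n. if x = y then of_real (walsh A (real y / 2 ^ n)) else 0)"
      using y(2) by (intro sum.cong) (auto simp: indicator_def dyad_def)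
    also have "\<dots> = of_real (walsh A (real y / 2 ^ n))" using y by (simp add: sum.delta)
    also have "real y = of_int \<lfloor>2 ^ n * t\<rfloor>" using that by (simp add: y_def)
    also have "walsh A (of_int \<lfloor>2 ^ n * t\<rfloor> / 2 ^ n) = walsh A t" by (rule walsh_dyadic[OF assms])
    finally show ?thesis ..
  qed
  have "L1_rel (\<lambda>t. of_real (walsh A t)) ?g"
    using L1_rel_walsh[of A, where 'k = 'k] g(1) eq unfolding L1_rel_def
    by (auto intro!: AE_I2 simp: space_restrict_space)
  then show ?thesis
    unfolding wal_def map_fun_apply id_apply g(2) using Quotient3_rel_abs[OF Quotient3_L1] by blast
qed

lemma dyint_wal:
  assumes "A \<subseteq> {..<n}" "x < 2 ^ n"
  shows "dyint n x (wal A) = of_real (walsh A (real x / 2 ^ n) / 2 ^ n)"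
proof -
  have "dyint n x (wal A) = (\<Sum>y<2 ^ n. walsh A (real y / 2 ^ n) *\<^sub>R (if x = y then of_real (1 / 2 ^ n) else 0))"
    by (simp add: wal_eq_sum_atoms[OF assms(1)] dyint_sum dyint_scaleR dyint_atom_grid[OF assms(2)] del: of_real_divide)
  also have "\<dots> = of_real (walsh A (real x / 2 ^ n) / 2 ^ n)"
    using assms(2) by (simp add: if_distrib[of "scaleR _"] sum.delta' cong: if_cong) (simp add: scaleR_conv_of_real)
  finally show ?thesis .
qed

section \<open>Operators factoring through the coordinate map\<close>

text \<open>The sets \<open>dyad (j+1) 1 = [2\<^sup>-\<^sup>j\<^sup>-\<^sup>1, 2\<^sup>-\<^sup>j)\<close> are disjoint. Their normalized indicators \<open>bump j\<close> span a
  copy of \<open>\<ell>\<^sub>1\<close>, and the integrals \<open>coef j\<close> are the coordinates of a projection onto it.\<close>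

definition coef :: "nat \<Rightarrow> 'k::{real_normed_field, banach, second_countable_topology} L1 \<Rightarrow> 'k" where
  "coef j = dyint (Suc j) 1"

definition bump :: "nat \<Rightarrow> 'k::{real_normed_field, banach, second_countable_topology} L1" where
  "bump j = 2 ^ Suc j *\<^sub>R atom (Suc j) 1"

lemma dyad_1_disjoint:
  assumes "i < j"
  shows "dyad (Suc i) 1 \<inter> dyad (Suc j) 1 = {}"
proof -
  have False if "t \<in> dyad (Suc i) 1" "t \<in> dyad (Suc j) 1" for t
  proof -
    have "1 \<le> 2 ^ Suc i * t" "2 ^ Suc j * t < 2"
      using that by (auto simp: dyad_def floor_eq_iff)
    moreover have "2 ^ Suc (Suc i) * t \<le> 2 ^ Suc j * t"
      using assms that by (intro mult_right_mono power_increasing) (auto simp: dyad_def)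
    ultimately show False by (simp add: mult_ac)
  qed
  then show ?thesis by blast
qed

lemma dyad_1_disjoint': "i \<noteq> j \<Longrightarrow> dyad (Suc i) 1 \<inter> dyad (Suc j) 1 = {}"
  using dyad_1_disjoint[of i j] dyad_1_disjoint[of j i] by (cases "i < j") auto

lemma coef_bump: "coef i (bump j) = (if i = j then 1 else 0)"
proof -
  have "measure leb01 (dyad (Suc j) 1) = 1 / 2 ^ Suc j"
    by (rule measure_dyad) (rule one_less_power, simp_all)
  then have "(2::real) ^ Suc j * measure leb01 (dyad (Suc j) 1) = 1" by simp
  then show ?thesis
    using dyad_1_disjoint'[of i j]
    by (auto simp: coef_def bump_def dyint_scaleR dyint_atom scaleR_conv_of_real
        simp del: of_real_power power_Suc One_nat_def simp flip: of_real_mult)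
qed

lemma norm_bump [simp]: "norm (bump j) = 1"
proof -
  have "norm (atom (Suc j) 1 :: 'a L1) = 1 / 2 ^ Suc j"
    by (rule norm_atom) (rule one_less_power, simp_all)
  then show ?thesis unfolding bump_def norm_scaleR by simp
qed

lemma coef_add: "coef j (f + g) = coef j f + coef j g"
  by (simp add: coef_def dyint_add)

lemma coef_diff: "coef j (f - g) = coef j f - coef j g"
  by (simp add: coef_def dyint_diff)

lemma coef_scaleL1: "coef j (c *\<^sub>1 f) = c * coef j f"
  by (simp add: coef_def dyint_scaleL1)

lemma coef_scaleR: "coef j (r *\<^sub>R f) = r *\<^sub>R coef j f"
  by (simp add: coef_def dyint_scaleR)

lemma sum_norm_coef_le: "(\<Sum>j<m. norm (coef j f)) \<le> norm f"
  unfolding coef_def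
  by (rule sum_norm_dyint_le) (simp, unfold disjoint_family_on_def, blast dest: dyad_1_disjoint')

lemma summable_norm_coef: "summable (\<lambda>j. norm (coef j f))"
  by (rule summableI_nonneg_bounded[OF _ sum_norm_coef_le]) simp

lemma suminf_norm_coef_le: "(\<Sum>j. norm (coef j f)) \<le> norm f"
  by (rule suminf_le_const[OF summable_norm_coef sum_norm_coef_le])

lemma summable_norm_coef_square: "summable (\<lambda>j. (norm (coef j f))\<^sup>2)"
proof (rule summable_comparison_test)
  have "norm (coef j f) \<le> norm f" for j
    using sum_norm_coef_le[of f "Suc j"] sum_nonneg[of "{..<j}" "\<lambda>j. norm (coef j f)"] by simp
  then show "\<exists>N. \<forall>j\<ge>N. norm ((norm (coef j f))\<^sup>2) \<le> norm f * norm (coef j f)"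
    by (auto simp: power2_eq_square intro!: mult_right_mono)
  show "summable (\<lambda>j. norm f * norm (coef j f))"
    by (intro summable_mult summable_norm_coef)
qed

text \<open>The operator that reads off the \<open>\<ell>\<^sub>1\<close> coordinates and sends the unit vector \<open>bump j\<close> to \<open>y j\<close>;
  it makes sense for every bounded sequence \<open>y\<close>.\<close>

definition bump_op :: "(nat \<Rightarrow> 'k L1) \<Rightarrow> 'k::{real_normed_field, banach, second_countable_topology} L1_map" where
  "bump_op y = Blinfun (\<lambda>f. \<Sum>j. coef j f *\<^sub>1 y j)"

lemma
  assumes y: "\<And>j. norm (y j) \<le> K"
  shows summable_norm_bump_op: "summable (\<lambda>j. norm (coef j f *\<^sub>1 y j))"
    and suminf_norm_bump_op: "(\<Sum>j. norm (coef j f *\<^sub>1 y j)) \<le> K * norm f"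
proof -
  have K: "K \<ge> 0" using y[of 0] by (meson norm_ge_zero order_trans)
  have le: "norm (coef j f *\<^sub>1 y j) \<le> K * norm (coef j f)" for j
    using y[of j] by (simp add: norm_scaleL1 mult.commute mult_right_mono)
  show s: "summable (\<lambda>j. norm (coef j f *\<^sub>1 y j))"
    by (rule summable_comparison_test[OF _ summable_mult[OF summable_norm_coef[of f], of K]])
      (use le in auto)
  have "(\<Sum>j. norm (coef j f *\<^sub>1 y j)) \<le> (\<Sum>j. K * norm (coef j f))"
    by (rule suminf_le[OF le s]) (intro summable_mult summable_norm_coef)
  also have "\<dots> = K * (\<Sum>j. norm (coef j f))" by (rule suminf_mult[OF summable_norm_coef])
  also have "\<dots> \<le> K * norm f" using K by (intro mult_left_mono suminf_norm_coef_le)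
  finally show "(\<Sum>j. norm (coef j f *\<^sub>1 y j)) \<le> K * norm f" .
qed

lemma
  assumes y: "\<And>j. norm (y j) \<le> K"
  shows bump_op_apply: "bump_op y f = (\<Sum>j. coef j f *\<^sub>1 y j)"
    and norm_bump_op_le: "norm (bump_op y) \<le> K"
proof -
  note sm = summable_norm_cancel[OF summable_norm_bump_op[of y K, OF y]]
  have K: "K \<ge> 0" using y[of 0] by (meson norm_ge_zero order_trans)
  have le: "norm (\<Sum>j. coef j f *\<^sub>1 y j) \<le> K * norm f" for f
    using summable_norm[OF summable_norm_bump_op[of y K f, OF y]] suminf_norm_bump_op[of y K f, OF y] by linarith
  have "bounded_linear (\<lambda>f. \<Sum>j. coef j f *\<^sub>1 y j)"
  proof (rule bounded_linear_intro[where K = K])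
    show "(\<Sum>j. coef j (f + g) *\<^sub>1 y j) = (\<Sum>j. coef j f *\<^sub>1 y j) + (\<Sum>j. coef j g *\<^sub>1 y j)" for f g
      by (simp add: coef_add L1.scale_left_distrib suminf_add[OF sm sm])
    show "(\<Sum>j. coef j (r *\<^sub>R f) *\<^sub>1 y j) = r *\<^sub>R (\<Sum>j. coef j f *\<^sub>1 y j)" for r f
      unfolding suminf_scaleR_right[OF sm] by (simp add: coef_scaleR) (simp add: scaleR_L1_eq scaleR_conv_of_real)
    show "norm (\<Sum>j. coef j f *\<^sub>1 y j) \<le> norm f * K" for f
      using le[of f] by (simp add: mult.commute)
  qed
  then show *: "bump_op y f = (\<Sum>j. coef j f *\<^sub>1 y j)" for f
    unfolding bump_op_def by (simp add: bounded_linear_Blinfun_apply)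
  show "norm (bump_op y) \<le> K"
    using le K by (intro norm_blinfun_bound) (simp_all add: *)
qed

lemma sums_bump_op:
  assumes "\<And>j. norm (y j) \<le> K"
  shows "(\<lambda>j. coef j f *\<^sub>1 y j) sums bump_op y f"
  unfolding bump_op_apply[OF assms]
  by (intro summable_sums summable_norm_cancel[OF summable_norm_bump_op[OF assms]])

lemma bump_op_in_L1_ops:
  assumes y: "\<And>j. norm (y j) \<le> K"
  shows "bump_op y \<in> L1_ops"
  unfolding L1_ops_def
proof safe
  fix c f
  have "(\<lambda>j. c *\<^sub>1 coef j f *\<^sub>1 y j) sums (c *\<^sub>1 bump_op y f)"
    by (rule bounded_linear.sums[OF bounded_linear_scaleL1 sums_bump_op[OF y]])
  moreover have "(\<lambda>j. c *\<^sub>1 coef j f *\<^sub>1 y j) sums bump_op y (c *\<^sub>1 f)"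
    using sums_bump_op[OF y, of "c *\<^sub>1 f"] by (simp add: coef_scaleL1)
  ultimately show "bump_op y (c *\<^sub>1 f) = c *\<^sub>1 bump_op y f" by (rule sums_unique2[symmetric])
qed

lemma bump_op_finite:
  assumes "\<And>j. norm (y j) \<le> K" "finite F" "\<And>j. j \<notin> F \<Longrightarrow> y j = 0 \<or> coef j f = 0"
  shows "bump_op y f = (\<Sum>j\<in>F. coef j f *\<^sub>1 y j)"
  unfolding bump_op_apply[OF assms(1)] using assms(2,3) by (intro suminf_finite) auto

lemma bump_op_bump:
  assumes "\<And>j. norm (y j) \<le> K"
  shows "bump_op y (bump i) = y i"
  using bump_op_finite[of y K "{i}" "bump i"] assms by (simp add: coef_bump)

lemma id_in_L1_ops: "id_blinfun \<in> L1_ops"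
  by (simp add: L1_ops_def)

lemma compose_in_L1_ops: "S \<in> L1_ops \<Longrightarrow> T \<in> L1_ops \<Longrightarrow> S o\<^sub>L T \<in> L1_ops"
  by (simp add: L1_ops_def)

lemma scale_in_L1_ops: "T \<in> L1_ops \<Longrightarrow> scale_op c T \<in> L1_ops"
  by (simp add: L1_ops_def scale_op_apply mult.commute)

lemma sum_in_L1_ops: "(\<And>i. i \<in> X \<Longrightarrow> T i \<in> L1_ops) \<Longrightarrow> sum T X \<in> L1_ops"
  by (simp add: L1_ops_def blinfun.sum_left L1.scale_sum_right)

text \<open>The two-sided ideal generated by \<open>J\<close>.\<close>

definition factor_ideal :: "'k L1_map \<Rightarrow> 'k::{real_normed_field, banach, second_countable_topology} L1_map set" where
  "factor_ideal J = {T. \<exists>(m::nat) A B. (\<forall>l<m. A l \<in> L1_ops \<and> B l \<in> L1_ops) \<and> T = (\<Sum>l<m. A l o\<^sub>L J o\<^sub>L B l)}"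

lemma factor_ideal_self: "J \<in> factor_ideal J"
  unfolding factor_ideal_def
  by (auto intro!: exI[of _ "1::nat"] exI[of _ "\<lambda>_. id_blinfun"] blinfun_eqI simp: id_in_L1_ops)

lemma L1_ideal_factor_ideal:
  assumes J: "J \<in> L1_ops"
  shows "L1_ideal (factor_ideal J)"
proof -
  have sub: "factor_ideal J \<subseteq> L1_ops"
    by (auto simp: factor_ideal_def intro!: sum_in_L1_ops compose_in_L1_ops J)
  have zero: "0 \<in> factor_ideal J"
    unfolding factor_ideal_def by (auto intro: exI[of _ "0::nat"])
  have add: "S + T \<in> factor_ideal J" if ST: "S \<in> factor_ideal J" "T \<in> factor_ideal J" for S T
  proof -
    obtain m :: nat and A B where S: "\<forall>l<m. A l \<in> L1_ops \<and> B l \<in> L1_ops" "S = (\<Sum>l<m. A l o\<^sub>L J o\<^sub>L B l)"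
      using ST(1) unfolding factor_ideal_def by blast
    obtain m' :: nat and A' B' where T: "\<forall>l<m'. A' l \<in> L1_ops \<and> B' l \<in> L1_ops" "T = (\<Sum>l<m'. A' l o\<^sub>L J o\<^sub>L B' l)"
      using ST(2) unfolding factor_ideal_def by blast
    define A'' where "A'' l = (if l < m then A l else A' (l - m))" for l
    define B'' where "B'' l = (if l < m then B l else B' (l - m))" for l
    have "(\<Sum>l<m + m'. A'' l o\<^sub>L J o\<^sub>L B'' l) = S + T"
    proof -
      have "{..<m + m'} = {..<m} \<union> (\<lambda>l. m + l) ` {..<m'}"
        by (auto simp: image_iff) (metis add_diff_inverse_nat nat_add_left_cancel_less lessThan_iff)
      then have "(\<Sum>l<m + m'. A'' l o\<^sub>L J o\<^sub>L B'' l)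
          = (\<Sum>l<m. A'' l o\<^sub>L J o\<^sub>L B'' l) + (\<Sum>l\<in>(\<lambda>l. m + l) ` {..<m'}. A'' l o\<^sub>L J o\<^sub>L B'' l)"
        by (simp add: sum.union_disjoint disjoint_iff image_iff)
      then show ?thesis
        by (simp add: sum.reindex S T A''_def B''_def)
    qed
    moreover have "\<forall>l<m + m'. A'' l \<in> L1_ops \<and> B'' l \<in> L1_ops"
      using S T by (auto simp: A''_def B''_def)
    ultimately show ?thesis
      unfolding factor_ideal_def mem_Collect_eq
      by (intro exI[of _ "m + m'"] exI[of _ A''] exI[of _ B'']) auto
  qed
  have scale: "scale_op c T \<in> factor_ideal J" if T: "T \<in> factor_ideal J" for c T
  proof -
    obtain m :: nat and A B where S: "\<forall>l<m. A l \<in> L1_ops \<and> B l \<in> L1_ops" "T = (\<Sum>l<m. A l o\<^sub>L J o\<^sub>L B l)"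
      using T unfolding factor_ideal_def by blast
    have "scale_op c T = (\<Sum>l<m. scale_op c (A l) o\<^sub>L J o\<^sub>L B l)"
      by (rule blinfun_eqI) (simp add: S scale_op_apply blinfun.sum_left L1.scale_sum_right)
    then show ?thesis
      unfolding factor_ideal_def mem_Collect_eq using S(1) scale_in_L1_ops[of _ c]
      by (intro exI[of _ m] exI[of _ "\<lambda>l. scale_op c (A l)"] exI[of _ B]) auto
  qed
  have comp: "S o\<^sub>L T \<in> factor_ideal J \<and> T o\<^sub>L S \<in> factor_ideal J" if T: "T \<in> factor_ideal J" and S: "S \<in> L1_ops" for S T
  proof -
    obtain m :: nat and A B where *: "\<forall>l<m. A l \<in> L1_ops \<and> B l \<in> L1_ops" "T = (\<Sum>l<m. A l o\<^sub>L J o\<^sub>L B l)"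
      using T unfolding factor_ideal_def by blast
    have "S o\<^sub>L T = (\<Sum>l<m. (S o\<^sub>L A l) o\<^sub>L J o\<^sub>L B l)" "T o\<^sub>L S = (\<Sum>l<m. A l o\<^sub>L J o\<^sub>L (B l o\<^sub>L S))"
      by (rule blinfun_eqI, simp add: * blinfun.sum_left blinfun.sum_right)+
    moreover have "S o\<^sub>L A l \<in> L1_ops" "B l o\<^sub>L S \<in> L1_ops" if "l < m" for l
      using * S that compose_in_L1_ops by blast+
    ultimately show ?thesis
      unfolding factor_ideal_def mem_Collect_eq using *(1) by meson
  qed
  show ?thesis
    unfolding L1_ideal_def L1_op.subspace_def using sub zero add scale comp by blast
qed

lemma L1_ideal_closure:
  assumes I: "L1_ideal I"
  shows "L1_ideal (closure I)"
proof -
  have sub: "closure I \<subseteq> L1_ops"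
    using I closed_L1_ops by (intro closure_minimal) (auto simp: L1_ideal_def)
  have zero: "0 \<in> closure I"
    using I closure_subset[of I] by (auto simp: L1_ideal_def L1_op.subspace_def)
  have add: "S + T \<in> closure I" if ST: "S \<in> closure I" "T \<in> closure I" for S T
  proof -
    obtain s t where "\<forall>n. s n \<in> I" "s \<longlonglongrightarrow> S" "\<forall>n. t n \<in> I" "t \<longlonglongrightarrow> T"
      using ST unfolding closure_sequential by blast
    then show ?thesis
      using I unfolding closure_sequential
      by (intro exI[of _ "\<lambda>n. s n + t n"]) (auto intro!: tendsto_add simp: L1_ideal_def L1_op.subspace_def)
  qed
  have image: "f T \<in> closure I" if "bounded_linear f" "\<And>T. T \<in> I \<Longrightarrow> f T \<in> I" "T \<in> closure I" for f T
    using image_closure_subset[of I f "closure I"] that closure_subset[of I]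
    by (auto intro: linear_continuous_on)
  have "bounded_linear (scale_op c :: 'a L1_map \<Rightarrow> _)" for c
  proof (rule bounded_linear_intro[where K = "norm c"])
    show "norm (scale_op c T) \<le> norm T * norm c" for T :: "'a L1_map"
      using mult_left_mono[OF norm_blinfun[of T], of "norm c"]
      by (intro norm_blinfun_bound) (auto simp: scale_op_apply norm_scaleL1 mult_ac)
    show "scale_op c (r *\<^sub>R T) = r *\<^sub>R scale_op c T" for r and T :: "'a L1_map"
      by (rule blinfun_eqI) (simp add: scale_op_apply scaleR_L1_eq blinfun.scaleR_left mult.commute)
  qed (rule L1_op.scale_right_distrib)
  moreover have "scale_op c T \<in> I" if "T \<in> I" for c T
    using I that by (auto simp: L1_ideal_def L1_op.subspace_def)
  ultimately have scale: "scale_op c T \<in> closure I" if "T \<in> closure I" for c T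
    using image that by blast
  have comp: "A o\<^sub>L T \<in> closure I \<and> T o\<^sub>L A \<in> closure I" if "T \<in> closure I" "A \<in> L1_ops" for T A
  proof
    show "A o\<^sub>L T \<in> closure I"
      by (rule image[OF bounded_bilinear.bounded_linear_right[OF bounded_bilinear_blinfun_compose] _ that(1)])
        (use I that(2) in \<open>auto simp: L1_ideal_def\<close>)
    show "T o\<^sub>L A \<in> closure I"
      by (rule image[OF bounded_bilinear.bounded_linear_left[OF bounded_bilinear_blinfun_compose] _ that(1)])
        (use I that(2) in \<open>auto simp: L1_ideal_def\<close>)
  qed
  show ?thesis
    unfolding L1_ideal_def L1_op.subspace_def using sub zero add scale comp by blast
qed

section \<open>Strict singularity\<close>

definition bounded_below_on :: "'k L1 set \<Rightarrow> 'k::{real_normed_field, banach, second_countable_topology} L1_map \<Rightarrow> bool" where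
  "bounded_below_on Z T \<longleftrightarrow> (\<exists>c>0. \<forall>z\<in>Z. c * norm z \<le> norm (T z))"

lemma strictly_singularI:
  fixes T :: "'k::{real_normed_field, banach, second_countable_topology} L1_map"
  assumes "\<And>Z. L1.subspace Z \<Longrightarrow> infinite_dimensional_L1 Z \<Longrightarrow> \<not> bounded_below_on Z T"
  shows "strictly_singular T"
  unfolding strictly_singular_def
proof (rule notI, elim exE conjE)
  fix Z g assume Z: "L1.subspace Z" "infinite_dimensional_L1 Z" and g: "homeomorphism Z (T ` Z) T g"
  have "0 \<in> Z" using Z by (simp add: L1.subspace_def)
  then have "0 \<in> T ` Z" by (metis blinfun.zero_right imageI)
  moreover have g0: "g 0 = 0" using g \<open>0 \<in> Z\<close> by (metis blinfun.zero_right homeomorphism_apply1)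
  ultimately obtain d where d: "d > 0" "\<And>y. y \<in> T ` Z \<Longrightarrow> dist y 0 < d \<Longrightarrow> dist (g y) 0 < 1"
    using homeomorphism_cont2[OF g] unfolding continuous_on_iff by (metis zero_less_one)
  have small: "norm z < 1" if "z \<in> Z" "norm (T z) < d" for z
    using d(2)[of "T z"] that homeomorphism_apply1[OF g] by simp
  have "d / 2 * norm z \<le> norm (T z)" if z: "z \<in> Z" for z
  proof (rule ccontr)
    assume "\<not> ?thesis"
    then have less: "norm (T z) < d / 2 * norm z" by simp
    then have nz: "norm z > 0" by (metis norm_ge_zero norm_zero blinfun.zero_right less_irrefl mult_zero_right zero_less_norm_iff)
    define w where "w = (2 / norm z) *\<^sub>R z"
    have "w \<in> Z" using z Z by (simp add: w_def scaleR_L1_eq L1.subspace_def)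
    moreover have "norm (T w) < d"
      using less nz by (simp add: w_def blinfun.scaleR_right field_simps)
    ultimately have "norm w < 1" by (rule small)
    then show False using nz by (simp add: w_def)
  qed
  then have "bounded_below_on Z T"
    unfolding bounded_below_on_def using d(1) by (intro exI[of _ "d / 2"]) auto
  with assms Z show False by blast
qed

text \<open>A bound from below by \<open>c\<close> on \<open>Z\<close> survives, with constant \<open>c/2\<close>, for every operator at distance less than
  \<open>c/2\<close>; so an operator in the closure that is bounded below on \<open>Z\<close> has a neighbour in \<open>I\<close> with that property.\<close>

lemma strictly_singular_closureI:
  fixes I :: "'k::{real_normed_field, banach, second_countable_topology} L1_map set"
  assumes "\<And>T Z. T \<in> I \<Longrightarrow> L1.subspace Z \<Longrightarrow> infinite_dimensional_L1 Z \<Longrightarrow> \<not> bounded_below_on Z T"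
    and "T \<in> closure I"
  shows "strictly_singular T"
proof (rule strictly_singularI)
  fix Z :: "'k L1 set"
  assume Z: "L1.subspace Z" "infinite_dimensional_L1 Z"
  show "\<not> bounded_below_on Z T"
  proof
    assume "bounded_below_on Z T"
    then obtain c where c: "c > 0" "\<And>z. z \<in> Z \<Longrightarrow> c * norm z \<le> norm (T z)"
      unfolding bounded_below_on_def by blast
    obtain U where U: "U \<in> I" "dist U T < c / 2"
      using assms(2) c(1) unfolding closure_approachable by (meson half_gt_zero)
    have "c / 2 * norm z \<le> norm (U z)" if "z \<in> Z" for z
    proof -
      have "norm (T z) \<le> norm (U z) + norm ((U - T) z)"
        by (metis blinfun.diff_left norm_triangle_sub add.commute norm_minus_commute)
      moreover have "norm ((U - T) z) \<le> c / 2 * norm z"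
        using U(2) norm_blinfun[of "U - T" z]
        by (smt (verit) dist_norm mult_right_mono norm_ge_zero)
      ultimately show ?thesis using c(2)[OF that] by simp
    qed
    then have "bounded_below_on Z U"
      unfolding bounded_below_on_def using c(1) by (intro exI[of _ "c / 2"]) auto
    with assms(1) U(1) Z show False by blast
  qed
qed

text \<open>Imposing one linear equation lowers the dimension by at most one: any \<open>w\<close> violating the equation spans the
  space together with the solutions.\<close>

lemma infinite_dimensional_kernel:
  fixes Z :: "'k::{real_normed_field, banach, second_countable_topology} L1 set"
  assumes "finite X" "L1.subspace Z" "infinite_dimensional_L1 Z"
    and add: "\<And>x f g. x \<in> X \<Longrightarrow> \<phi> x (f + g) = \<phi> x f + \<phi> x g"
    and scale: "\<And>x c f. x \<in> X \<Longrightarrow> \<phi> x (c *\<^sub>1 f) = (c :: 'k) * \<phi> x f"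
  shows "L1.subspace {z \<in> Z. \<forall>x\<in>X. \<phi> x z = 0} \<and> infinite_dimensional_L1 {z \<in> Z. \<forall>x\<in>X. \<phi> x z = 0}"
  using assms(1) add scale
proof (induction X rule: finite_induct)
  case empty
  then show ?case using assms by simp
next
  case (insert x X)
  define W where "W = {z \<in> Z. \<forall>x\<in>X. \<phi> x z = 0}"
  define V where "V = {z \<in> W. \<phi> x z = 0}"
  have W: "L1.subspace W" "infinite_dimensional_L1 W"
    using insert unfolding W_def by auto
  have add: "\<phi> x (f + g) = \<phi> x f + \<phi> x g" and scale: "\<phi> x (c *\<^sub>1 f) = c * \<phi> x f" for f g c
    using insert.prems by auto
  have "\<phi> x 0 = 0" using scale[of 0 0] by simp
  then have V: "L1.subspace V"
    using W(1) by (auto simp: L1.subspace_def V_def add scale)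
  have "infinite_dimensional_L1 V"
    unfolding infinite_dimensional_L1_def
  proof (rule notI, elim exE conjE)
    fix B assume B: "finite B" "V = L1.span B"
    show False
    proof (cases "\<exists>w\<in>W. \<phi> x w \<noteq> 0")
      case True
      then obtain w where w: "w \<in> W" "\<phi> x w \<noteq> 0" by blast
      have "W = L1.span (insert w B)"
      proof
        show "L1.span (insert w B) \<subseteq> W"
          using L1.span_superset[of B] w(1) W(1) B(2) unfolding V_def
          by (intro L1.span_minimal) auto
        show "W \<subseteq> L1.span (insert w B)"
        proof
          fix z assume z: "z \<in> W"
          define c where "c = - \<phi> x z / \<phi> x w"
          have "z + c *\<^sub>1 w \<in> V"
            using z w L1.subspace_add[OF W(1)] L1.subspace_scale[OF W(1)]
            unfolding V_def by (simp add: add scale) (simp add: c_def)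
          then have "z + c *\<^sub>1 w \<in> L1.span (insert w B)"
            using B(2) L1.span_mono[of B "insert w B"] by auto
          moreover have "c *\<^sub>1 w \<in> L1.span (insert w B)"
            by (intro L1.span_scale L1.span_base) simp
          ultimately show "z \<in> L1.span (insert w B)"
            using L1.span_diff[of "z + c *\<^sub>1 w" "insert w B" "c *\<^sub>1 w"] by simp
        qed
      qed
      then show False using W(2) B(1) unfolding infinite_dimensional_L1_def by blast
    next
      case False
      then have "V = W" by (auto simp: V_def)
      then show False using W(2) B unfolding infinite_dimensional_L1_def by blast
    qed
  qed
  moreover have "V = {z \<in> Z. \<forall>x\<in>insert x X. \<phi> x z = 0}"
    by (auto simp: V_def W_def)
  ultimately show ?case using V by simp
qed

text \<open>This expresses that \<open>J\<close> factors as the coordinate map into \<open>\<ell>\<^sub>1\<close>, the inclusion of \<open>\<ell>\<^sub>1\<close> in \<open>\<ell>\<^sub>2\<close> and a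
  contraction defined on the range, without introducing the spaces in between.\<close>

definition hilbertian :: "'k::{real_normed_field, banach, second_countable_topology} L1_map \<Rightarrow> bool" where
  "hilbertian J \<longleftrightarrow> (\<forall>f. (norm (J f))\<^sup>2 \<le> (\<Sum>j. (norm (coef j f))\<^sup>2))"

lemma hilbertian_factor_bound:
  fixes J :: "'k::{real_normed_field, banach, second_countable_topology} L1_map"
  assumes J: "hilbertian J"
  shows "(norm ((\<Sum>l<m. A l o\<^sub>L J o\<^sub>L B l) f))\<^sup>2
    \<le> (\<Sum>l<m. (norm (A l))\<^sup>2) * (\<Sum>l<m. \<Sum>j. (norm (coef j (B l f)))\<^sup>2)"
proof -
  have "norm ((\<Sum>l<m. A l o\<^sub>L J o\<^sub>L B l) f) \<le> (\<Sum>l<m. norm (A l (J (B l f))))"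
    by (simp add: blinfun.sum_left norm_sum)
  also have "\<dots> \<le> (\<Sum>l<m. norm (A l) * norm (J (B l f)))"
    by (intro sum_mono norm_blinfun)
  finally have "(norm ((\<Sum>l<m. A l o\<^sub>L J o\<^sub>L B l) f))\<^sup>2 \<le> (\<Sum>l<m. norm (A l) * norm (J (B l f)))\<^sup>2"
    by (intro power_mono) auto
  also have "\<dots> \<le> (\<Sum>l<m. (norm (A l))\<^sup>2) * (\<Sum>l<m. (norm (J (B l f)))\<^sup>2)"
    by (rule Cauchy_Schwarz_ineq_sum)
  also have "\<dots> \<le> (\<Sum>l<m. (norm (A l))\<^sup>2) * (\<Sum>l<m. \<Sum>j. (norm (coef j (B l f)))\<^sup>2)"
    using J by (intro mult_left_mono sum_mono sum_nonneg) (auto simp: hilbertian_def)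
  finally show ?thesis .
qed

text \<open>Here \<open>a j\<close> is a sequence of seminorms, thought of as moduli of coordinates. If \<open>Z\<close> contains vectors
  supported arbitrarily far out, then its sup norm does not control its \<open>\<ell>\<^sub>1\<close> norm: adding to \<open>z\<close> a vector \<open>y\<close>
  of sup norm \<open>1\<close> that vanishes where \<open>z\<close> lives, up to a tail of \<open>\<ell>\<^sub>1\<close> norm below \<open>1/4\<close>, keeps the sup norm at
  most \<open>2\<close> and raises the \<open>\<ell>\<^sub>1\<close> norm by at least \<open>1/2\<close>.\<close>

lemma spread_vectors:
  fixes a :: "nat \<Rightarrow> 'v::real_vector \<Rightarrow> real" and Z :: "'v set"
  assumes add_Z: "\<And>y z. y \<in> Z \<Longrightarrow> z \<in> Z \<Longrightarrow> y + z \<in> Z"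
    and scale_Z: "\<And>r z. z \<in> Z \<Longrightarrow> r *\<^sub>R z \<in> Z" and "0 \<in> Z"
    and nonneg: "\<And>j z. 0 \<le> a j z"
    and add: "\<And>j y z. a j (y + z) \<le> a j y + a j z"
    and scale: "\<And>j r z. a j (r *\<^sub>R z) = \<bar>r\<bar> * a j z"
    and summable: "\<And>z. summable (\<lambda>j. a j z)"
    and tail: "\<And>N. \<exists>y\<in>Z. (\<forall>j<N. a j y = 0) \<and> (\<exists>j. a j y \<noteq> 0)"
  shows "\<exists>z\<in>Z. (\<forall>j. a j z \<le> 2) \<and> real n / 2 \<le> (\<Sum>j. a j z)"
proof (induction n)
  case 0
  have "a j 0 = 0" for j using scale[of j 0 0] by simp
  then show ?case using \<open>0 \<in> Z\<close> by (intro bexI[of _ 0]) auto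
next
  case (Suc n)
  then obtain z where z: "z \<in> Z" "\<And>j. a j z \<le> 2" "real n / 2 \<le> (\<Sum>j. a j z)" by blast
  obtain N where N: "(\<Sum>j. a (j + N) z) < 1 / 4"
    using order_tendstoD(2)[OF suminf_exist_split2[OF summable[of z]], of "1 / 4"] eventually_sequentially by auto
  obtain y0 where y0: "y0 \<in> Z" "\<And>j. j < N \<Longrightarrow> a j y0 = 0" "\<exists>j. a j y0 \<noteq> 0"
    using tail[of N] by blast
  have bdd: "bdd_above (range (\<lambda>j. a j y0))"
    using summable_LIMSEQ_zero[OF summable[of y0]]
    by (metis Bseq_eq_bounded bounded_imp_bdd_above convergentI convergent_imp_Bseq)
  \<comment> \<open>normalize to sup norm \<open>1\<close>\<close>
  define s where "s = (SUP j. a j y0)"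
  have le_s: "a j y0 \<le> s" for j unfolding s_def by (rule cSUP_upper[OF _ bdd]) simp
  have s: "s > 0" using y0(3) le_s nonneg by (metis order_le_less order_less_le_trans)
  define y where "y = (1 / s) *\<^sub>R y0"
  have y: "y \<in> Z" "\<And>j. j < N \<Longrightarrow> a j y = 0" "\<And>j. a j y \<le> 1"
    using y0 s le_s by (auto simp: y_def scale scale_Z)
  have sum_y: "1 \<le> (\<Sum>j. a j y)"
  proof -
    have "a j y0 \<le> s * (\<Sum>j. a j y)" for j
      using sum_le_suminf[OF summable[of y], of "{j}"] nonneg s
      by (simp add: y_def scale field_simps)
    then have "s \<le> s * (\<Sum>j. a j y)"
      unfolding s_def by (intro cSUP_least) auto
    then show ?thesis using s by simp
  qed
  have tail_z: "a j z \<le> 1 / 4" if "j \<ge> N" for j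
  proof -
    have "a (j - N + N) z \<le> (\<Sum>j. a (j + N) z)"
      using sum_le_suminf[of "\<lambda>j. a (j + N) z" "{j - N}"] summable_ignore_initial_segment[OF summable, of N z] nonneg
      by simp
    then show ?thesis using N that by simp
  qed
  have minus: "a j (- w) = a j w" for j w using scale[of j "- 1" w] by simp
  have lower: "\<bar>a j y - a j z\<bar> \<le> a j (z + y)" for j
    using add[of j "z + y" "- z"] add[of j "z + y" "- y"] by (simp add: minus)
  have "a j (z + y) \<le> 2" for j
    using add[of j z y] y(2,3)[of j] z(2)[of j] tail_z[of j] by (cases "j < N") auto
  moreover have "real (Suc n) / 2 \<le> (\<Sum>j. a j (z + y))"
  proof -
    have "(\<Sum>j. a j z) + (\<Sum>j. a j y) - 2 * (\<Sum>j. a (j + N) z) \<le> (\<Sum>j. a j (z + y))"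
    proof -
      have sp: "(\<Sum>j. a j w) = (\<Sum>j. a (j + N) w) + (\<Sum>j<N. a j w)" for w
        by (rule suminf_split_initial_segment[OF summable])
      have sh: "summable (\<lambda>j. a (j + N) w)" for w
        by (rule summable_ignore_initial_segment[OF summable])
      have "(\<Sum>j<N. a j y) = 0" using y(2) by simp
      moreover have "(\<Sum>j<N. a j z) \<le> (\<Sum>j<N. a j (z + y))"
        using lower y(2) by (intro sum_mono) (metis abs_le_D2 diff_0 lessThan_iff minus_diff_eq diff_zero)
      moreover have "(\<Sum>j. a (j + N) y) - (\<Sum>j. a (j + N) z) \<le> (\<Sum>j. a (j + N) (z + y))"
        unfolding suminf_diff[OF sh sh]
        using lower by (intro suminf_le summable_diff sh) (meson abs_le_D1)
      ultimately show ?thesis using sp[of z] sp[of y] sp[of "z + y"] by linarith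
    qed
    then show ?thesis using z(3) sum_y N by simp
  qed
  ultimately show ?case using add_Z[OF z(1) y(1)] by blast
qed

lemma suminf_square_le:
  fixes b :: "nat \<Rightarrow> real"
  assumes "summable b" "\<And>j. 0 \<le> b j" "\<And>j. b j \<le> s"
  shows "summable (\<lambda>j. (b j)\<^sup>2)" "(\<Sum>j. (b j)\<^sup>2) \<le> s * (\<Sum>j. b j)"
proof -
  have le: "(b j)\<^sup>2 \<le> s * b j" for j
    using assms by (simp add: power2_eq_square mult_right_mono)
  show 1: "summable (\<lambda>j. (b j)\<^sup>2)"
    by (rule summable_comparison_test[OF _ summable_mult[OF assms(1), of s]]) (use le in auto)
  show "(\<Sum>j. (b j)\<^sup>2) \<le> s * (\<Sum>j. b j)"
    unfolding suminf_mult[OF assms(1), symmetric]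
    by (intro suminf_le le 1 summable_mult assms(1))
qed

lemma sum_square_le_square_sum:
  fixes b :: "'i \<Rightarrow> real"
  assumes "finite I" "\<And>i. i \<in> I \<Longrightarrow> 0 \<le> b i"
  shows "(\<Sum>i\<in>I. (b i)\<^sup>2) \<le> (\<Sum>i\<in>I. b i)\<^sup>2"
  using assms
proof (induction I rule: finite_induct)
  case (insert i I)
  have "0 \<le> b i * (\<Sum>i\<in>I. b i)" using insert by (simp add: sum_nonneg)
  then show ?case using insert by (simp add: power2_sum)
qed simp

text \<open>With \<open>a j z\<close> the total size of the \<open>j\<close>-th coordinates of the vectors \<open>B\<^sub>l z\<close>, the square of \<open>norm (T z)\<close> is
  at most a constant times \<open>\<Sum> a\<^sub>j\<^sup>2 \<le> sup a\<^sub>j \<cdot> \<Sum> a\<^sub>j\<close>, where \<open>\<Sum> a\<^sub>j\<close> is at most a constant times \<open>norm z\<close>. The vectors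
  found by \<open>spread_vectors\<close> have \<open>sup a\<^sub>j \<le> 2\<close> and \<open>\<Sum> a\<^sub>j\<close> unbounded, which contradicts a lower bound for \<open>T\<close>.\<close>

lemma factor_ideal_not_bounded_below:
  fixes J :: "'k::{real_normed_field, banach, second_countable_topology} L1_map"
  assumes J: "hilbertian J" and T: "T \<in> factor_ideal J"
    and Z: "L1.subspace Z" "infinite_dimensional_L1 Z"
  shows "\<not> bounded_below_on Z T"
proof
  assume "bounded_below_on Z T"
  then obtain c where c: "c > 0" "\<And>z. z \<in> Z \<Longrightarrow> c * norm z \<le> norm (T z)"
    unfolding bounded_below_on_def by blast
  obtain m :: nat and A B where AB: "\<forall>l<m. A l \<in> L1_ops \<and> B l \<in> L1_ops" "T = (\<Sum>l<m. A l o\<^sub>L J o\<^sub>L B l)"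
    using T unfolding factor_ideal_def by blast
  define K where "K = (\<Sum>l<m. (norm (A l))\<^sup>2)"
  define C where "C = (\<Sum>l<m. norm (B l))"
  have "K \<ge> 0" "C \<ge> 0" by (simp_all add: K_def C_def sum_nonneg)
  define a where "a j z = (\<Sum>l<m. norm (coef j (B l z)))" for j z
  have summable_a: "summable (\<lambda>j. a j z)" for z
    unfolding a_def by (intro summable_sum summable_norm_coef)
  have a_nonneg: "0 \<le> a j z" for j z by (simp add: a_def sum_nonneg)
  have sum_a: "(\<Sum>j. a j z) \<le> C * norm z" for z
  proof -
    have "(\<Sum>j. a j z) = (\<Sum>l<m. \<Sum>j. norm (coef j (B l z)))"
      unfolding a_def by (intro suminf_sum summable_norm_coef)
    also have "\<dots> \<le> (\<Sum>l<m. norm (B l) * norm z)"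
      by (intro sum_mono order_trans[OF suminf_norm_coef_le norm_blinfun])
    finally show ?thesis by (simp add: C_def sum_distrib_right)
  qed
  have upper: "(norm (T z))\<^sup>2 \<le> K * (s * (\<Sum>j. a j z))" if "\<And>j. a j z \<le> s" for z s
  proof -
    have "(norm (T z))\<^sup>2 \<le> K * (\<Sum>l<m. \<Sum>j. (norm (coef j (B l z)))\<^sup>2)"
      unfolding AB(2) K_def by (rule hilbertian_factor_bound[OF J])
    also have "(\<Sum>l<m. \<Sum>j. (norm (coef j (B l z)))\<^sup>2) = (\<Sum>j. \<Sum>l<m. (norm (coef j (B l z)))\<^sup>2)"
      by (intro suminf_sum[symmetric] summable_norm_coef_square)
    also have "\<dots> \<le> (\<Sum>j. (a j z)\<^sup>2)"
    proof (rule suminf_le)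
      show "(\<Sum>l<m. (norm (coef j (B l z)))\<^sup>2) \<le> (a j z)\<^sup>2" for j
        unfolding a_def by (rule sum_square_le_square_sum) auto
      show "summable (\<lambda>j. (a j z)\<^sup>2)"
        by (rule suminf_square_le(1)) (use that summable_a a_nonneg in auto)
    qed (intro summable_sum summable_norm_coef_square)
    also have "\<dots> \<le> s * (\<Sum>j. a j z)"
      by (rule suminf_square_le(2)) (use that summable_a a_nonneg in auto)
    finally show ?thesis using \<open>K \<ge> 0\<close> by (simp add: mult_left_mono)
  qed
  have tail: "\<exists>y\<in>Z. (\<forall>j<N. a j y = 0) \<and> (\<exists>j. a j y \<noteq> 0)" for N
  proof -
    define Y where "Y = {z \<in> Z. \<forall>x\<in>{..<N} \<times> {..<m}. coef (fst x) (B (snd x) z) = 0}"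
    have "L1.subspace Y \<and> infinite_dimensional_L1 Y"
      unfolding Y_def
    proof (rule infinite_dimensional_kernel[OF _ Z])
      fix x :: "nat \<times> nat" and c f assume "x \<in> {..<N} \<times> {..<m}"
      then have "B (snd x) \<in> L1_ops" using AB by auto
      then show "coef (fst x) (B (snd x) (c *\<^sub>1 f)) = c * coef (fst x) (B (snd x) f)"
        by (simp add: L1_ops_def coef_scaleL1)
    qed (auto simp: blinfun.add_right coef_add)
    moreover have "Y \<noteq> {0}"
      using calculation L1.span_empty unfolding infinite_dimensional_L1_def by (metis finite.emptyI)
    ultimately obtain y where y: "y \<in> Y" "y \<noteq> 0" by (metis L1.subspace_0 insertI1 subsetI subset_singletonD empty_iff singletonI is_singletonI' is_singleton_def)
    have "\<exists>j. a j y \<noteq> 0"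
    proof (rule ccontr)
      assume "\<nexists>j. a j y \<noteq> 0"
      then have "(norm (T y))\<^sup>2 \<le> 0" using upper[of y 0] by simp
      then have "T y = 0" by simp
      then show False using c(2)[of y] c(1) y by (simp add: Y_def mult_le_0_iff)
    qed
    moreover have "y \<in> Z" "\<forall>j<N. a j y = 0" using y(1) by (auto simp: Y_def a_def)
    ultimately show ?thesis by blast
  qed
  have spread: "\<exists>z\<in>Z. (\<forall>j. a j z \<le> 2) \<and> real n / 2 \<le> (\<Sum>j. a j z)" for n
  proof (rule spread_vectors)
    show "a j (y + z) \<le> a j y + a j z" for j y z
      by (simp add: a_def blinfun.add_right coef_add sum.distrib[symmetric] sum_mono norm_triangle_ineq)
    show "a j (r *\<^sub>R z) = \<bar>r\<bar> * a j z" for j r z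
      by (simp add: a_def blinfun.scaleR_right coef_scaleR sum_distrib_left)
  qed (use Z(1) a_nonneg summable_a tail in \<open>auto simp: L1.subspace_def scaleR_L1_eq\<close>)
  have bound: "real n \<le> 2 * (C * (2 * K * C / c\<^sup>2))" for n
  proof -
    obtain z where z: "z \<in> Z" "\<And>j. a j z \<le> 2" "real n / 2 \<le> (\<Sum>j. a j z)"
      using spread by blast
    have "(c * norm z)\<^sup>2 \<le> (norm (T z))\<^sup>2"
      using c z(1) by (intro power_mono) auto
    also have "\<dots> \<le> K * (2 * (\<Sum>j. a j z))" by (rule upper[OF z(2)])
    also have "\<dots> \<le> K * (2 * (C * norm z))"
      using \<open>K \<ge> 0\<close> sum_a by (intro mult_left_mono) auto
    finally have "norm z * (c\<^sup>2 * norm z) \<le> norm z * (2 * K * C)"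
      by (simp add: power2_eq_square mult_ac)
    then have "c\<^sup>2 * norm z \<le> 2 * K * C"
      using \<open>K \<ge> 0\<close> \<open>C \<ge> 0\<close> by (cases "norm z = 0") (auto simp: mult_le_cancel_left)
    then have "norm z \<le> 2 * K * C / c\<^sup>2"
      using c(1) by (simp add: field_simps)
    then have "C * norm z \<le> C * (2 * K * C / c\<^sup>2)"
      using \<open>C \<ge> 0\<close> by (rule mult_left_mono)
    then show ?thesis using z(3) sum_a[of z] by linarith
  qed
  obtain n where "2 * (C * (2 * K * C / c\<^sup>2)) < real n" using reals_Archimedean2 by blast
  with bound[of n] show False by simp
qed

lemma small_ideal_closure_factor_ideal:
  assumes "J \<in> L1_ops" "hilbertian J"
  shows "small_ideal (closure (factor_ideal J))"
proof -
  have I: "L1_ideal (closure (factor_ideal J))"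
    by (intro L1_ideal_closure L1_ideal_factor_ideal assms)
  moreover have "strictly_singular T" if "T \<in> closure (factor_ideal J)" for T
    using strictly_singular_closureI[OF factor_ideal_not_bounded_below[OF assms(2)] that] .
  ultimately show ?thesis
    unfolding small_ideal_def L1_ideal_def by blast
qed

section \<open>The ideals are not closed\<close>

text \<open>By the parallelogram law one of \<open>u + e\<^sub>n\<close> and \<open>u - e\<^sub>n\<close> has \<open>Q\<close>-value at most \<open>Q u + Q e\<^sub>n\<close>.\<close>

lemma exists_signs:
  fixes Q :: "'v::real_vector \<Rightarrow> real"
  assumes par: "\<And>u v. Q (u + v) + Q (u - v) = 2 * Q u + 2 * Q v" and Q: "\<And>k. Q (e k) \<le> C"
  shows "\<exists>\<epsilon>. (\<forall>k. \<epsilon> k \<in> {1, - 1 :: real}) \<and> Q (\<Sum>k<n. \<epsilon> k *\<^sub>R e k) \<le> real n * C"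
proof (induction n)
  case 0
  have "Q 0 = 0" using par[of 0 0] by simp
  then show ?case by (intro exI[of _ "\<lambda>_. 1"]) auto
next
  case (Suc n)
  then obtain \<epsilon> where \<epsilon>: "\<And>k. \<epsilon> k \<in> {1, - 1 :: real}" "Q (\<Sum>k<n. \<epsilon> k *\<^sub>R e k) \<le> real n * C" by blast
  define u where "u = (\<Sum>k<n. \<epsilon> k *\<^sub>R e k)"
  have "Q (u + e n) \<le> real (Suc n) * C \<or> Q (u - e n) \<le> real (Suc n) * C"
    using par[of u "e n"] Q[of n] \<epsilon>(2) by (simp add: u_def algebra_simps) linarith
  then obtain \<delta> where \<delta>: "\<delta> \<in> {1, - 1 :: real}" "Q (u + \<delta> *\<^sub>R e n) \<le> real (Suc n) * C"
    by (metis diff_conv_add_uminus insertCI scaleR_minus1_left scaleR_one)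
  have "(\<Sum>k<Suc n. (\<epsilon>(n := \<delta>)) k *\<^sub>R e k) = u + \<delta> *\<^sub>R e n"
    by (simp add: u_def)
  with \<delta> \<epsilon>(1) show ?case by (intro exI[of _ "\<epsilon>(n := \<delta>)"]) auto
qed

text \<open>The exponent \<open>-1/4\<close> is negative, so the sequence tends to \<open>0\<close>, and larger than \<open>-1/2\<close>, so that the sum of
  the first \<open>n\<close> terms is not bounded by a multiple of \<open>n\<^sup>1\<^sup>/\<^sup>2\<close>.\<close>

definition slow :: "nat \<Rightarrow> real" where "slow k = 1 / sqrt (sqrt (real (Suc k)))"

lemma slow_nonneg: "0 \<le> slow k" by (simp add: slow_def)
lemma slow_antimono: "i \<le> j \<Longrightarrow> slow j \<le> slow i"
  by (simp add: slow_def frac_le)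
lemma slow_le_1: "slow k \<le> 1" by (simp add: slow_def)

lemma slow_tendsto_0: "slow \<longlonglongrightarrow> 0"
  unfolding slow_def
  by (intro tendsto_divide_0[OF tendsto_const] filterlim_at_top_imp_at_infinity
      filterlim_compose[OF sqrt_at_top] filterlim_compose[OF filterlim_real_sequentially] filterlim_Suc)

definition slow_diagonal :: "'k::{real_normed_field, banach, second_countable_topology} L1_map" where
  "slow_diagonal = bump_op (\<lambda>k. slow k *\<^sub>R bump k)"

lemma norm_slow_bump: "norm (slow k *\<^sub>R bump k) \<le> 1"
  by (simp add: slow_nonneg slow_le_1)

text \<open>Operators in the ideal are dominated by a quadratic form \<open>Q\<close> that is bounded on the \<open>bump k\<close>. Signs chosen by
  \<open>exists_signs\<close> then give a combination of \<open>n\<close> of them whose image has norm of order at most \<open>n\<^sup>1\<^sup>/\<^sup>2\<close>, but the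
  diagonal operator maps it to a vector of norm at least \<open>n \<cdot> n\<^sup>-\<^sup>1\<^sup>/\<^sup>4\<close> whatever the signs are.\<close>

lemma slow_diagonal_notin:
  fixes J :: "'k::{real_normed_field, euclidean_space} L1_map"
  assumes J: "hilbertian J"
  shows "slow_diagonal \<notin> factor_ideal J"
proof
  assume "slow_diagonal \<in> factor_ideal J"
  then obtain m :: nat and A B :: "nat \<Rightarrow> 'k L1_map" where AB: "slow_diagonal = (\<Sum>l<m. A l o\<^sub>L J o\<^sub>L B l)"
    unfolding factor_ideal_def by blast
  define K where "K = (\<Sum>l<m. (norm (A l))\<^sup>2)"
  define C where "C = (\<Sum>l<m. (norm (B l))\<^sup>2)"
  have "K \<ge> 0" "C \<ge> 0" by (simp_all add: K_def C_def sum_nonneg)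
  define Q where "Q z = (\<Sum>l<m. \<Sum>j. (norm (coef j (B l z)))\<^sup>2)" for z
  have upper: "(norm (slow_diagonal z))\<^sup>2 \<le> K * Q z" for z
    unfolding AB K_def Q_def by (rule hilbertian_factor_bound[OF J])
  have par: "Q (u + v) + Q (u - v) = 2 * Q u + 2 * Q v" for u v
  proof -
    have s: "summable (\<lambda>j. (norm (coef j f + coef j g))\<^sup>2)" "summable (\<lambda>j. (norm (coef j f - coef j g))\<^sup>2)" for f g :: "'k L1"
      using summable_norm_coef_square[of "f + g"] summable_norm_coef_square[of "f - g"]
      by (simp_all add: coef_add coef_diff)
    have "(\<Sum>j. (norm (coef j f + coef j g))\<^sup>2) + (\<Sum>j. (norm (coef j f - coef j g))\<^sup>2)
        = 2 * (\<Sum>j. (norm (coef j f))\<^sup>2) + 2 * (\<Sum>j. (norm (coef j g))\<^sup>2)" for f g :: "'k L1"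
    proof -
      have "(norm (x + y))\<^sup>2 + (norm (x - y))\<^sup>2 = 2 * (norm x)\<^sup>2 + 2 * (norm y)\<^sup>2" for x y :: 'k
        by (simp add: power2_norm_eq_inner inner_simps inner_commute)
      then show ?thesis
        using summable_norm_coef_square[of f] summable_norm_coef_square[of g]
        by (simp add: suminf_add[OF s] suminf_mult[symmetric] suminf_add summable_mult)
    qed
    then show ?thesis
      by (simp add: Q_def blinfun.add_right blinfun.diff_right coef_add coef_diff
          sum.distrib[symmetric] sum_distrib_left)
  qed
  have bump: "Q (bump k) \<le> C" for k
    unfolding Q_def C_def
  proof (rule sum_mono)
    fix l
    let ?f = "B l (bump k)"
    have le: "norm (coef j ?f) \<le> norm ?f" for j
      using sum_norm_coef_le[of ?f "Suc j"] sum_nonneg[of "{..<j}" "\<lambda>j. norm (coef j ?f)"] by simp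
    have "(\<Sum>j. (norm (coef j ?f))\<^sup>2) \<le> norm ?f * (\<Sum>j. norm (coef j ?f))"
      by (rule suminf_square_le(2)[OF summable_norm_coef _ le]) simp
    also have "\<dots> \<le> norm ?f * norm ?f"
      by (intro mult_left_mono suminf_norm_coef_le) simp
    also have "\<dots> \<le> norm (B l) * norm (B l)"
      using norm_blinfun[of "B l" "bump k"] by (intro mult_mono) auto
    finally show "(\<Sum>j. (norm (coef j ?f))\<^sup>2) \<le> (norm (B l))\<^sup>2" by (simp add: power2_eq_square)
  qed
  have bound: "sqrt (real n) \<le> K * C" if n: "n > 0" for n
  proof -
    obtain \<epsilon> where \<epsilon>: "\<And>k. \<epsilon> k \<in> {1, - 1 :: real}" "Q (\<Sum>k<n. \<epsilon> k *\<^sub>R bump k) \<le> real n * C"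
      using exists_signs[of Q bump C n, OF par bump] by blast
    define z :: "'k L1" where "z = (\<Sum>k<n. \<epsilon> k *\<^sub>R bump k)"
    have Dz: "slow_diagonal z = (\<Sum>k<n. \<epsilon> k *\<^sub>R slow k *\<^sub>R bump k)"
      by (simp add: z_def blinfun.sum_right blinfun.scaleR_right slow_diagonal_def bump_op_bump[OF norm_slow_bump])
    have "norm (coef j (slow_diagonal z)) = slow j" if "j < n" for j
    proof -
      have "coef j (slow_diagonal z) = (\<Sum>k<n. coef j (\<epsilon> k *\<^sub>R slow k *\<^sub>R bump k))"
        unfolding Dz coef_def by (rule dyint_sum)
      also have "\<dots> = (\<Sum>k<n. if j = k then (\<epsilon> j * slow j) *\<^sub>R 1 else 0)"
        by (intro sum.cong) (auto simp: coef_scaleR coef_bump)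
      also have "\<dots> = (\<epsilon> j * slow j) *\<^sub>R 1" using that by simp
      finally show ?thesis using \<epsilon>(1)[of j] slow_nonneg[of j] by (auto simp: abs_mult)
    qed
    then have "(\<Sum>j<n. slow j) \<le> norm (slow_diagonal z)"
      using sum_norm_coef_le[of "slow_diagonal z" n] by simp
    moreover have "(\<Sum>j<n. slow (n - 1)) \<le> (\<Sum>j<n. slow j)"
      by (intro sum_mono slow_antimono) auto
    ultimately have "real n * slow (n - 1) \<le> norm (slow_diagonal z)" by simp
    then have "(real n * slow (n - 1))\<^sup>2 \<le> (norm (slow_diagonal z))\<^sup>2"
      by (intro power_mono) (auto simp: slow_nonneg)
    also have "\<dots> \<le> K * Q z" by (rule upper)
    also have "\<dots> \<le> K * (real n * C)" using \<open>K \<ge> 0\<close> \<epsilon>(2) by (intro mult_left_mono) (auto simp: z_def)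
    finally have "(real n)\<^sup>2 * (slow (n - 1))\<^sup>2 \<le> K * (real n * C)" by (simp add: power_mult_distrib)
    moreover have "(slow (n - 1))\<^sup>2 = 1 / sqrt (real n)"
      using n by (simp add: slow_def power_divide)
    moreover have "(real n)\<^sup>2 / sqrt (real n) = real n * sqrt (real n)"
      by (simp add: power2_eq_square real_div_sqrt flip: times_divide_eq_right)
    ultimately have "real n * sqrt (real n) \<le> real n * (K * C)" by (simp add: mult_ac)
    then show ?thesis using n by simp
  qed
  obtain n where n: "(K * C)\<^sup>2 + 1 < real n" using reals_Archimedean2 by blast
  then have "n > 0" by (metis gr0I not_less of_nat_0 add_nonneg_nonneg zero_le_one zero_le_power2)
  moreover have "K * C < sqrt (real n)" using n by (intro real_less_rsqrt) simp
  ultimately show False using bound[of n] by simp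
qed

text \<open>The truncated diagonals have finite rank. To write a rank one summand as \<open>A J B\<close>, let \<open>B\<close> send the
  required coordinate to \<open>bump i\<close> and let \<open>A\<close> recover the scalar from the
  Walsh function \<open>J (bump i)\<close> by integrating over the first atom, on which that function is \<open>1\<close>.\<close>

lemma slow_diagonal_in_closure:
  fixes J :: "'k::{real_normed_field, banach, second_countable_topology} L1_map"
  assumes "J (bump i) = wal A" "finite A" and J: "J \<in> L1_ops"
  shows "slow_diagonal \<in> closure (factor_ideal J)"
proof -
  obtain n where n: "A \<subseteq> {..<n}" using assms(2) finite_nat_iff_bounded by blast
  define D :: "nat \<Rightarrow> 'k L1_map" where "D N = bump_op (\<lambda>k. if k < N then slow k *\<^sub>R bump k else 0)" for N
  have bnd: "norm (if k < N then slow k *\<^sub>R bump k else 0) \<le> 1" for k N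
    using norm_slow_bump[of k] by simp
  have D_in: "D N \<in> factor_ideal J" for N
  proof -
    define B :: "nat \<Rightarrow> 'k L1_map" where "B l = bump_op (\<lambda>k. if k = l then bump i else 0)" for l
    have B: "norm (if k = l then bump i else 0) \<le> 1" for k l by simp
    define F where "F l f = (2 ^ n * dyint n 0 f) *\<^sub>1 (slow l *\<^sub>R bump l :: 'k L1)" for l f
    have bl: "bounded_linear (F l)" for l
    proof (rule bounded_linear_intro[where K = "2 ^ n * norm (slow l *\<^sub>R bump l :: 'k L1)"])
      show "F l (f + g) = F l f + F l g" for f g
        by (simp add: F_def dyint_add distrib_left L1.scale_left_distrib)
      show "F l (r *\<^sub>R f) = r *\<^sub>R F l f" for r f
        unfolding F_def dyint_scaleR by (simp add: scaleR_L1_eq scaleR_conv_of_real mult_ac)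
      have "norm (dyint n 0 f) \<le> norm f" for f :: "'k L1"
        using sum_norm_dyint_le[of "{()}" "\<lambda>_. n" "\<lambda>_. 0" f] by (simp add: disjoint_family_on_def)
      then show "norm (F l f) \<le> norm f * (2 ^ n * norm (slow l *\<^sub>R bump l :: 'k L1))" for f
        by (simp add: F_def norm_scaleL1 norm_mult norm_power mult_right_mono mult_ac slow_nonneg del: norm_scaleR norm_bump)
    qed
    have F_ops: "Blinfun (F l) \<in> L1_ops" for l
      using bl by (simp add: L1_ops_def bounded_linear_Blinfun_apply F_def dyint_scaleL1 mult_ac)
    have "D N = (\<Sum>l<N. Blinfun (F l) o\<^sub>L J o\<^sub>L B l)"
    proof (rule blinfun_eqI)
      fix f
      have D: "D N f = (\<Sum>l<N. coef l f *\<^sub>1 slow l *\<^sub>R bump l)"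
        unfolding D_def using bump_op_finite[of "\<lambda>k. if k < N then slow k *\<^sub>R bump k else 0" 1 "{..<N}" f, OF bnd] by simp
      have "B l f = coef l f *\<^sub>1 bump i" for l
        unfolding B_def using bump_op_finite[of "\<lambda>k. if k = l then bump i else 0" 1 "{l}" f for l, OF B] by simp
      then have "J (B l f) = coef l f *\<^sub>1 wal A" for l
        using assms(1) J by (simp add: L1_ops_def)
      moreover have "F l (c *\<^sub>1 wal A) = c *\<^sub>1 slow l *\<^sub>R bump l" for l c
      proof -
        have "dyint n 0 (wal A :: 'k L1) = of_real (1 / 2 ^ n)"
          using dyint_wal[OF n, of 0] by simp
        then show ?thesis by (simp add: F_def dyint_scaleL1)
      qed
      ultimately show "D N f = (\<Sum>l<N. Blinfun (F l) o\<^sub>L J o\<^sub>L B l) f"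
        by (simp add: D blinfun.sum_left bounded_linear_Blinfun_apply[OF bl])
    qed
    then show ?thesis
      unfolding factor_ideal_def mem_Collect_eq using F_ops bump_op_in_L1_ops[OF B]
      by (intro exI[of _ N] exI[of _ "\<lambda>l. Blinfun (F l)"] exI[of _ B]) (auto simp: B_def)
  qed
  have "norm (D N - slow_diagonal) \<le> slow N" for N
  proof -
    define y :: "nat \<Rightarrow> 'k L1" where "y k = (if k < N then 0 else slow k *\<^sub>R bump k)" for k
    have y: "norm (y k) \<le> slow N" for k
      by (auto simp: y_def slow_nonneg intro: slow_antimono)
    have "slow_diagonal - D N = bump_op y"
    proof (rule blinfun_eqI)
      fix f
      have "(\<lambda>k. coef k f *\<^sub>1 slow k *\<^sub>R bump k - coef k f *\<^sub>1 (if k < N then slow k *\<^sub>R bump k else 0))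
          sums (slow_diagonal f - D N f)"
        unfolding D_def slow_diagonal_def
        by (rule sums_diff[OF sums_bump_op[OF norm_slow_bump] sums_bump_op[OF bnd]])
      moreover have "coef k f *\<^sub>1 slow k *\<^sub>R bump k - coef k f *\<^sub>1 (if k < N then slow k *\<^sub>R bump k else 0)
          = coef k f *\<^sub>1 y k" for k
        by (simp add: y_def)
      ultimately have "(\<lambda>k. coef k f *\<^sub>1 y k) sums (slow_diagonal f - D N f)" by simp
      from sums_unique2[OF this sums_bump_op[of y "slow N" f, OF y]]
      show "(slow_diagonal - D N) f = bump_op y f"
        by (simp add: blinfun.diff_left)
    qed
    then show ?thesis
      using norm_bump_op_le[OF y] by (simp add: norm_minus_commute)
  qed
  then have "(\<lambda>N. D N - slow_diagonal) \<longlonglongrightarrow> 0"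
    by (intro Lim_null_comparison[OF _ slow_tendsto_0]) auto
  then have "D \<longlonglongrightarrow> slow_diagonal" by (rule LIM_zero_cancel)
  then show ?thesis unfolding closure_sequential using D_in by blast
qed

section \<open>Separating the closures\<close>

lemma parseval:
  fixes w :: "'i \<Rightarrow> 'x \<Rightarrow> real" and b :: "'i \<Rightarrow> 'v::real_inner"
  assumes "finite F"
    and orth: "\<And>i j. i \<in> F \<Longrightarrow> j \<in> F \<Longrightarrow> (\<Sum>x\<in>X. w i x * w j x) = (if i = j then N else 0)"
  shows "(\<Sum>x\<in>X. (norm (\<Sum>j\<in>F. w j x *\<^sub>R b j))\<^sup>2) = N * (\<Sum>j\<in>F. (norm (b j))\<^sup>2)"
proof -
  have "(\<Sum>x\<in>X. (norm (\<Sum>j\<in>F. w j x *\<^sub>R b j))\<^sup>2)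
      = (\<Sum>x\<in>X. \<Sum>i\<in>F. \<Sum>j\<in>F. (w i x * w j x) * (b i \<bullet> b j))"
    by (simp add: power2_norm_eq_inner inner_sum_left inner_sum_right sum_distrib_left mult_ac) (simp add: inner_commute mult_ac)
  also have "\<dots> = (\<Sum>i\<in>F. \<Sum>j\<in>F. (\<Sum>x\<in>X. w i x * w j x) * (b i \<bullet> b j))"
    by (subst sum.swap, intro sum.cong refl, subst sum.swap) (simp add: sum_distrib_right)
  also have "\<dots> = (\<Sum>i\<in>F. \<Sum>j\<in>F. if i = j then N * (b i \<bullet> b i) else 0)"
    by (intro sum.cong refl) (auto simp: orth)
  also have "\<dots> = N * (\<Sum>j\<in>F. (norm (b j))\<^sup>2)"
    using assms(1) by (simp add: power2_norm_eq_inner sum_distrib_left)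
  finally show ?thesis .
qed

text \<open>The Bessel inequality for the real orthogonal system \<open>w i\<close>, with vector values: expand the square of the
  distance from \<open>N z\<close> to its projection, where \<open>z\<close> is \<open>y\<close> extended by \<open>0\<close> outside \<open>E\<close>.\<close>

lemma bessel:
  fixes w :: "'i \<Rightarrow> 'x \<Rightarrow> real" and y :: "'x \<Rightarrow> 'v::real_inner"
  assumes F: "finite F" and X: "finite X" "E \<subseteq> X" and N: "N > 0"
    and orth: "\<And>i j. i \<in> F \<Longrightarrow> j \<in> F \<Longrightarrow> (\<Sum>x\<in>X. w i x * w j x) = (if i = j then N else 0)"
  shows "(\<Sum>i\<in>F. (norm (\<Sum>x\<in>E. w i x *\<^sub>R y x))\<^sup>2) \<le> N * (\<Sum>x\<in>E. (norm (y x))\<^sup>2)"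
proof -
  define z where "z x = (if x \<in> E then y x else 0)" for x
  define c where "c i = (\<Sum>x\<in>X. w i x *\<^sub>R z x)" for i
  define p where "p x = (\<Sum>i\<in>F. w i x *\<^sub>R c i)" for x
  have "(\<Sum>x\<in>X. z x \<bullet> p x) = (\<Sum>x\<in>X. \<Sum>i\<in>F. (w i x *\<^sub>R z x) \<bullet> c i)"
    by (simp add: p_def inner_sum_right)
  also have "\<dots> = (\<Sum>i\<in>F. c i \<bullet> c i)"
    unfolding c_def inner_sum_left by (rule sum.swap)
  finally have zp: "(\<Sum>x\<in>X. z x \<bullet> p x) = (\<Sum>i\<in>F. (norm (c i))\<^sup>2)"
    by (simp add: power2_norm_eq_inner)
  have pp: "(\<Sum>x\<in>X. (norm (p x))\<^sup>2) = N * (\<Sum>i\<in>F. (norm (c i))\<^sup>2)"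
    unfolding p_def by (rule parseval[OF F orth])
  have "0 \<le> (\<Sum>x\<in>X. (norm (N *\<^sub>R z x - p x))\<^sup>2)" by (simp add: sum_nonneg)
  also have "\<dots> = (\<Sum>x\<in>X. N\<^sup>2 * (norm (z x))\<^sup>2 - 2 * N * (z x \<bullet> p x) + (norm (p x))\<^sup>2)"
    unfolding power2_norm_eq_inner
    by (intro sum.cong refl) (simp add: inner_diff_left inner_diff_right inner_commute algebra_simps power2_eq_square)
  also have "\<dots> = N\<^sup>2 * (\<Sum>x\<in>X. (norm (z x))\<^sup>2) - 2 * N * (\<Sum>x\<in>X. z x \<bullet> p x) + (\<Sum>x\<in>X. (norm (p x))\<^sup>2)"
    by (simp add: sum.distrib sum_subtractf sum_distrib_left)
  also have "\<dots> = N * (N * (\<Sum>x\<in>X. (norm (z x))\<^sup>2) - (\<Sum>i\<in>F. (norm (c i))\<^sup>2))"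
    unfolding zp pp by (simp add: power2_eq_square[of N] algebra_simps)
  finally have "(\<Sum>i\<in>F. (norm (c i))\<^sup>2) \<le> N * (\<Sum>x\<in>X. (norm (z x))\<^sup>2)"
    using N by (simp add: zero_le_mult_iff)
  moreover have "c i = (\<Sum>x\<in>E. w i x *\<^sub>R y x)" for i
    unfolding c_def using X by (intro sum.mono_neutral_cong_right) (auto simp: z_def)
  moreover have "(\<Sum>x\<in>X. (norm (z x))\<^sup>2) = (\<Sum>x\<in>E. (norm (y x))\<^sup>2)"
    using X by (intro sum.mono_neutral_cong_right) (auto simp: z_def)
  ultimately show ?thesis by simp
qed

context walsh_blocks
begin

lemma R_less: "R k < R (Suc k)"
proof -
  have "1 + R k \<le> (k + 1) * (R k + 1 + (1 + fact (2 * h k))\<^sup>2 * (\<beta> k)\<^sup>2) + R k" by simp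
  with large[of k] show ?thesis by linarith
qed

lemma walsh_orthogonal:
  assumes "v i \<subseteq> {..<n'}" "v j \<subseteq> {..<n'}"
  shows "(\<Sum>x<2 ^ n'. walsh (v i) (real x / 2 ^ n') * walsh (v j) (real x / 2 ^ n')) = (if i = j then 2 ^ n' else 0)"
proof (cases "i = j")
  case False
  then have "v i \<noteq> v j" using inj_v by (auto dest: injD)
  then show ?thesis
    using assms False by (simp add: walsh_mult finite_v) (intro sum_walsh_eq_0; auto)
qed simp

lemma common_level:
  assumes "finite F"
  obtains n' where "\<And>j. j \<in> F \<Longrightarrow> v j \<subseteq> {..<n'}"
proof -
  have "finite (\<Union>j\<in>F. v j)" using assms finite_v by blast
  then obtain n' where "(\<Union>j\<in>F. v j) \<subseteq> {..<n'}" using finite_nat_iff_bounded by blast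
  then show ?thesis by (intro that) auto
qed

text \<open>The \<open>L\<^sub>1\<close> norm is at most the \<open>L\<^sub>2\<close> norm, which is computed on a grid fine enough for all the functions.\<close>

lemma norm_sum_wal_le:
  fixes b :: "nat \<Rightarrow> 'k::{real_normed_field, euclidean_space}"
  assumes F: "finite F"
  shows "(norm (\<Sum>j\<in>F. b j *\<^sub>1 wal (v j)))\<^sup>2 \<le> (\<Sum>j\<in>F. (norm (b j))\<^sup>2)"
proof -
  obtain n' where n': "\<And>j. j \<in> F \<Longrightarrow> v j \<subseteq> {..<n'}" by (rule common_level[OF F]) blast
  define w where "w j x = walsh (v j) (real x / 2 ^ n')" for j x
  define g where "g x = (\<Sum>j\<in>F. w j x *\<^sub>R b j)" for x
  have "(\<Sum>j\<in>F. b j *\<^sub>1 wal (v j)) = (\<Sum>j\<in>F. \<Sum>x<2 ^ n'. (w j x *\<^sub>R b j) *\<^sub>1 atom n' x)"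
    by (intro sum.cong refl)
      (simp add: wal_eq_sum_atoms[OF n'] w_def L1.scale_sum_right scaleR_L1_eq scaleR_conv_of_real mult.commute)
  also have "\<dots> = (\<Sum>x<2 ^ n'. g x *\<^sub>1 atom n' x)"
    by (subst sum.swap) (simp add: g_def L1.scale_sum_left)
  finally have "norm (\<Sum>j\<in>F. b j *\<^sub>1 wal (v j)) \<le> (\<Sum>x<2 ^ n'. norm (g x) * (1 / 2 ^ n'))"
    by (auto intro!: order_trans[OF norm_sum] sum_mono simp: norm_scaleL1 norm_atom)
  then have "(norm (\<Sum>j\<in>F. b j *\<^sub>1 wal (v j)))\<^sup>2 \<le> (\<Sum>x<2 ^ n'. norm (g x) * (1 / 2 ^ n'))\<^sup>2"
    by (intro power_mono) auto
  also have "\<dots> \<le> (\<Sum>x<2 ^ n'. (norm (g x))\<^sup>2) * (\<Sum>x<(2::nat) ^ n'. (1 / 2 ^ n')\<^sup>2)"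
    by (rule Cauchy_Schwarz_ineq_sum)
  also have "(\<Sum>x<2 ^ n'. (norm (g x))\<^sup>2) = 2 ^ n' * (\<Sum>j\<in>F. (norm (b j))\<^sup>2)"
    unfolding g_def by (rule parseval[OF F]) (use n' walsh_orthogonal in \<open>auto simp: w_def\<close>)
  also have "2 ^ n' * (\<Sum>j\<in>F. (norm (b j))\<^sup>2) * (\<Sum>x<(2::nat) ^ n'. (1 / 2 ^ n')\<^sup>2) = (\<Sum>j\<in>F. (norm (b j))\<^sup>2)"
    by (simp add: power2_eq_square)
  finally show ?thesis .
qed

definition block_op :: "nat set \<Rightarrow> 'k::{real_normed_field, banach, second_countable_topology} L1_map" where
  "block_op S = bump_op (\<lambda>j. if j \<in> S then wal (v j) else 0)"

lemma norm_block_le: "norm (if j \<in> S then wal (v j) else 0) \<le> 1"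
  by (simp add: norm_wal)

lemma block_op_in_L1_ops: "block_op S \<in> L1_ops"
  unfolding block_op_def by (rule bump_op_in_L1_ops[OF norm_block_le])

lemma block_op_bump: "i \<in> S \<Longrightarrow> block_op S (bump i) = wal (v i)"
  unfolding block_op_def by (simp add: bump_op_bump[OF norm_block_le])

lemma block_op_tendsto:
  "(\<lambda>n0. \<Sum>j\<in>S \<inter> {..<n0}. coef j f *\<^sub>1 wal (v j)) \<longlonglongrightarrow> block_op S f"
proof -
  have "(\<Sum>j<n0. coef j f *\<^sub>1 (if j \<in> S then wal (v j) else 0)) = (\<Sum>j\<in>S \<inter> {..<n0}. coef j f *\<^sub>1 wal (v j))" for n0
    by (intro sum.mono_neutral_cong_right) auto
  then show ?thesis
    using sums_bump_op[of "\<lambda>j. if j \<in> S then wal (v j) else 0" 1 f, OF norm_block_le] by (simp add: sums_def block_op_def)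
qed

lemma hilbertian_block_op:
  "hilbertian (block_op S :: 'k::{real_normed_field, euclidean_space} L1_map)"
  unfolding hilbertian_def
proof
  fix f :: "'k L1"
  have "(norm (\<Sum>j\<in>S \<inter> {..<n0}. coef j f *\<^sub>1 wal (v j)))\<^sup>2 \<le> (\<Sum>j. (norm (coef j f))\<^sup>2)" for n0
    by (rule order_trans[OF norm_sum_wal_le sum_le_suminf]) (auto intro: summable_norm_coef_square)
  moreover have "(\<lambda>n0. (norm (\<Sum>j\<in>S \<inter> {..<n0}. coef j f *\<^sub>1 wal (v j)))\<^sup>2) \<longlonglongrightarrow> (norm (block_op S f))\<^sup>2"
    by (intro tendsto_intros block_op_tendsto)
  ultimately show "(norm (block_op S f))\<^sup>2 \<le> (\<Sum>j. (norm (coef j f))\<^sup>2)"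
    by (intro LIMSEQ_le_const2) auto
qed

text \<open>The dual Khinchine inequality for the blocks after block \<open>k\<close>, whose Walsh functions are independent up to
  order \<open>2 h k\<close>.\<close>

lemma sum_square_later_blocks_le:
  assumes F: "finite F" "F \<subseteq> {R (Suc k)..}" and n': "\<And>j. j \<in> F \<Longrightarrow> v j \<subseteq> {..<n'}"
    and C: "C \<ge> 0" and \<theta>: "\<And>q. q < 2 ^ n' \<Longrightarrow> \<bar>\<theta> q\<bar> \<le> C / 2 ^ n'" "(\<Sum>q<2 ^ n'. \<bar>\<theta> q\<bar>) \<le> \<tau>"
  shows "(\<Sum>j\<in>F. (\<Sum>q<2 ^ n'. walsh (v j) (real q / 2 ^ n') * \<theta> q)\<^sup>2)
    \<le> (real (\<beta> k) * \<tau> + C * fact (2 * h k) / real (\<beta> k) ^ (2 * h k - 1))\<^sup>2"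
proof (rule sum_square_functional_le)
  show "{..<(2::nat) ^ n'} \<noteq> {}" by (simp add: lessThan_empty_iff)
  have "(2::nat) ^ n k > 0" by simp
  then have "\<beta> k > 0" using h_pos[of k] unfolding grid by (cases "\<beta> k = 0") auto
  then show "real (\<beta> k) > 0" by simp
  show "(\<Sum>q<2 ^ n'. (\<Sum>j\<in>F. c j * walsh (v j) (real q / 2 ^ n')) ^ (2 * h k))
      \<le> real (card {..<(2::nat) ^ n'}) * fact (2 * h k) * (\<Sum>j\<in>F. (c j)\<^sup>2) ^ h k" for c
  proof (rule even_moment_le[where I = F and p = "2 * h k"])
    fix G assume G: "finite G" "G \<subseteq> F" "G \<noteq> {}" "card G \<le> 2 * h k"
    have "xor_family v G \<subseteq> {..<n'}"
      using xor_family_subset[of v G] n' G(2) by blast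
    moreover have "xor_family v G \<noteq> {}" using G F by (intro independent) auto
    ultimately show "(\<Sum>q<2 ^ n'. \<Prod>j\<in>G. walsh (v j) (real q / 2 ^ n')) = 0"
      by (simp add: prod_walsh[OF G(1) finite_v] sum_walsh_eq_0)
  qed (use F in auto)
qed (use assms h_pos in auto)

text \<open>Each Walsh function \<open>w\<^sub>i\<close> of block \<open>k\<close> is tested against the element of the ideal applied to \<open>bump i\<close>.
  Closeness in norm makes the pairing, restricted to a set \<open>E\<close> of at least three quarters of the
  atoms, at least \<open>1/4\<close>. On the other side the restricted pairing is a combination, with coefficients bounded in \<open>\<ell>\<^sub>1\<close> and hence in \<open>\<ell>\<^sub>2\<close>, of the Fourier coefficients
  along \<open>w\<^sub>i\<close> of the functions \<open>A\<^sub>l (wal (v j))\<close> with \<open>j\<close> outside the block. Summing the squares over \<open>i\<close> and using Bessel's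
  inequality reduces the claim to a bound for \<open>\<Sum>\<^sub>j |y\<^sub>j(x)|\<^sup>2\<close> at each atom \<open>x \<in> E\<close>. There \<open>E\<close> is needed: averaging over an atom
  after applying \<open>A\<^sub>l\<close> is a functional whose total mass \<open>\<tau>\<close> adds up to at most \<open>C\<close> over all atoms, and \<open>E\<close>
  consists of the atoms where it is not much larger than average. The earlier blocks contribute few terms, the
  later ones are controlled by the dual Khinchine inequality.\<close>

lemma block_obstruction:
  fixes A B :: "nat \<Rightarrow> 'k::{real_normed_field, euclidean_space} L1_map"
  assumes A: "\<And>l. l < m \<Longrightarrow> A l \<in> L1_ops" "\<And>l. l < m \<Longrightarrow> norm (A l) \<le> C"
    and B: "\<And>l. l < m \<Longrightarrow> norm (B l) \<le> C" and C: "C > 0"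
    and S: "S \<inter> {R k..<R (Suc k)} = {}"
    and near: "\<And>i. R k \<le> i \<Longrightarrow> i < R (Suc k) \<Longrightarrow>
      norm (wal (v i) - (\<Sum>l<m. A l o\<^sub>L block_op S o\<^sub>L B l) (bump i)) < 1 / 2"
  shows "real (R (Suc k) - R k) \<le> 16 * (real m * C)\<^sup>2 * real m * real DIM('k) * (4 * real m * C)\<^sup>2 *
    (real (R k) + (1 + fact (2 * h k))\<^sup>2 * (real (\<beta> k))\<^sup>2)"
proof -
  define N :: real where "N = 2 ^ n k"
  have N: "N > 0" by (simp add: N_def)
  define bl where "bl = {R k..<R (Suc k)}"
  have "finite bl" by (simp add: bl_def)
  define b where "b l i j = coef j (B l (bump i))" for l i j
  have "\<forall>i\<in>bl. \<forall>\<^sub>F n0 in sequentially.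
      norm (wal (v i) - (\<Sum>l<m. A l (\<Sum>j\<in>S \<inter> {..<n0}. b l i j *\<^sub>1 wal (v j)))) < 1 / 2"
  proof
    fix i assume i: "i \<in> bl"
    have "(\<lambda>n0. norm (wal (v i) - (\<Sum>l<m. A l (\<Sum>j\<in>S \<inter> {..<n0}. b l i j *\<^sub>1 wal (v j)))))
        \<longlonglongrightarrow> norm (wal (v i) - (\<Sum>l<m. A l (block_op S (B l (bump i)))))"
      unfolding b_def by (intro tendsto_intros block_op_tendsto)
    moreover have "norm (wal (v i) - (\<Sum>l<m. A l (block_op S (B l (bump i))))) < 1 / 2"
      using near[of i] i by (simp add: blinfun.sum_left bl_def)
    ultimately show "\<forall>\<^sub>F n0 in sequentially.
        norm (wal (v i) - (\<Sum>l<m. A l (\<Sum>j\<in>S \<inter> {..<n0}. b l i j *\<^sub>1 wal (v j)))) < 1 / 2"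
      by (rule order_tendstoD(2))
  qed
  then have "\<forall>\<^sub>F n0 in sequentially. \<forall>i\<in>bl.
      norm (wal (v i) - (\<Sum>l<m. A l (\<Sum>j\<in>S \<inter> {..<n0}. b l i j *\<^sub>1 wal (v j)))) < 1 / 2"
    by (rule eventually_ball_finite[OF \<open>finite bl\<close>])
  then obtain n0 where n0: "\<And>i. i \<in> bl \<Longrightarrow>
      norm (wal (v i) - (\<Sum>l<m. A l (\<Sum>j\<in>S \<inter> {..<n0}. b l i j *\<^sub>1 wal (v j)))) < 1 / 2"
    unfolding eventually_sequentially by blast
  \<comment> \<open>truncating first makes the grid below, and with it \<open>\<tau>\<close> and \<open>E\<close>, independent of \<open>i\<close>\<close>
  define F where "F = S \<inter> {..<n0}"
  have F: "finite F" by (simp add: F_def)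
  obtain n' where n': "\<And>j. j \<in> F \<Longrightarrow> v j \<subseteq> {..<n'}" by (rule common_level[OF F]) blast
  define w where "w i x = walsh (v i) (real x / 2 ^ n k)" for i x
  define a where "a l x q = dyint (n k) x (A l (atom n' q))" for l x q
  define y where "y l j x = dyint (n k) x (A l (wal (v j)))" for l j x
  define \<tau> where "\<tau> l x = (\<Sum>q<2 ^ n'. norm (a l x q))" for l x
  have y_eq: "y l j x = (\<Sum>q<2 ^ n'. walsh (v j) (real q / 2 ^ n') *\<^sub>R a l x q)" if "j \<in> F" for l j x
    by (simp add: y_def a_def wal_eq_sum_atoms[OF n'[OF that]] blinfun.sum_right blinfun.scaleR_right
        dyint_sum dyint_scaleR)
  have norm_Aatom: "norm (A l (atom n' q)) \<le> C / 2 ^ n'" if "l < m" "q < 2 ^ n'" for l q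
  proof -
    have "norm (A l (atom n' q)) \<le> norm (A l) * norm (atom n' q :: 'k L1)" by (rule norm_blinfun)
    also have "\<dots> \<le> C * (1 / 2 ^ n')"
      using A(2)[OF that(1)] that(2) C by (intro mult_mono) (auto simp: norm_atom)
    finally show ?thesis by simp
  qed
  have a_le: "norm (a l x q) \<le> C / 2 ^ n'" if "l < m" "q < 2 ^ n'" for l x q
    using norm_Aatom[OF that] sum_norm_dyint_le[of "{()}" "\<lambda>_. n k" "\<lambda>_. x" "A l (atom n' q)"]
    by (simp add: a_def disjoint_family_on_def)
  have sum_\<tau>: "(\<Sum>x<2 ^ n k. \<tau> l x) \<le> C" if "l < m" for l
  proof -
    have "(\<Sum>x<2 ^ n k. \<tau> l x) = (\<Sum>q<2 ^ n'. \<Sum>x<2 ^ n k. norm (a l x q))"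
      unfolding \<tau>_def by (rule sum.swap)
    also have "\<dots> \<le> (\<Sum>q<(2::nat) ^ n'. C / 2 ^ n')"
      unfolding a_def using that by (intro sum_mono order_trans[OF sum_norm_dyint_grid_le norm_Aatom]) auto
    also have "\<dots> = C" by simp
    finally show ?thesis .
  qed
  define E where "E = {x. x < 2 ^ n k \<and> (\<forall>l<m. \<tau> l x \<le> 4 * real m * C / N)}"
  have E: "finite E" "E \<subseteq> {..<2 ^ n k}" by (auto simp: E_def)
  \<comment> \<open>Markov: for each of the \<open>m\<close> operators at most a fraction \<open>1 / (4 m)\<close> of the atoms is lost\<close>
  have card_E: "3 / 4 * N \<le> real (card E)"
  proof -
    define bad where "bad l = {x. x < 2 ^ n k \<and> \<tau> l x > 4 * real m * C / N}" for l
    have bad: "real (card (bad l)) * (4 * real m) \<le> N" if "l < m" for l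
    proof -
      have "real (card (bad l)) * (4 * real m * C / N) = (\<Sum>x\<in>bad l. 4 * real m * C / N)" by simp
      also have "\<dots> \<le> (\<Sum>x\<in>bad l. \<tau> l x)" by (intro sum_mono) (auto simp: bad_def)
      also have "\<dots> \<le> (\<Sum>x<2 ^ n k. \<tau> l x)"
        by (intro sum_mono2) (auto simp: bad_def \<tau>_def sum_nonneg)
      also have "\<dots> \<le> C" by (rule sum_\<tau>[OF that])
      finally show ?thesis using C N by (simp add: field_simps)
    qed
    have "real (card ({..<2 ^ n k} - E)) \<le> N / 4"
    proof (cases "m = 0")
      case True
      then have "{..<2 ^ n k} - E = {}" by (auto simp: E_def)
      then show ?thesis using N by (simp only: card.empty)
    next
      case False
      have "{..<2 ^ n k} - E \<subseteq> (\<Union>l<m. bad l)" by (auto simp: E_def bad_def not_le)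
      then have "card ({..<2 ^ n k} - E) \<le> card (\<Union>l<m. bad l)"
        by (intro card_mono) (auto simp: bad_def)
      also have "\<dots> \<le> (\<Sum>l<m. card (bad l))" by (rule card_UN_le) simp
      finally have "real (card ({..<2 ^ n k} - E)) * (4 * real m) \<le> (\<Sum>l<m. real (card (bad l)) * (4 * real m))"
        unfolding sum_distrib_right[symmetric] by (intro mult_right_mono) (simp_all flip: of_nat_sum)
      also have "\<dots> \<le> (\<Sum>l<m. N)" by (intro sum_mono bad) simp
      finally show ?thesis using False by (simp add: field_simps)
    qed
    moreover have "real (card ({..<2 ^ n k} - E)) = N - real (card E)"
      using E card_mono[OF _ E(2)] by (simp add: card_Diff_subset N_def of_nat_diff)
    ultimately show ?thesis by simp
  qed
  have orth: "(\<Sum>x<2 ^ n k. w i x * w j x) = (if i = j then N else 0)" if "i \<in> bl" "j \<in> bl" for i j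
    unfolding w_def N_def
    by (rule walsh_orthogonal) (use that block_support[of k] in \<open>auto simp: bl_def\<close>)
  define c where "c l j i = (\<Sum>x\<in>E. w i x *\<^sub>R y l j x)" for l j i
  have each: "1 / 16 \<le> (real m * C)\<^sup>2 * (\<Sum>(l, j)\<in>{..<m} \<times> F. (norm (c l j i))\<^sup>2)" if i: "i \<in> bl" for i
  proof -
    have vi: "v i \<subseteq> {..<n k}" using i block_support[of k i] by (simp add: bl_def)
    define T where "T = (\<Sum>l<m. A l (\<Sum>j\<in>F. b l i j *\<^sub>1 wal (v j)))"
    have dT: "dyint (n k) x (wal (v i) - T) = of_real (w i x / N) - (\<Sum>(l, j)\<in>{..<m} \<times> F. b l i j * y l j x)"
      if "x < 2 ^ n k" for x
    proof -
      have "T = (\<Sum>l<m. \<Sum>j\<in>F. b l i j *\<^sub>1 A l (wal (v j)))"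
        unfolding T_def using A(1) by (intro sum.cong refl) (simp add: blinfun.sum_right L1_ops_def)
      then show ?thesis
        using that by (simp add: dyint_diff dyint_sum dyint_scaleL1 y_def dyint_wal[OF vi] w_def N_def
            sum.cartesian_product[symmetric])
    qed
    have "(\<Sum>x\<in>E. w i x *\<^sub>R dyint (n k) x (wal (v i) - T))
        = (\<Sum>x\<in>E. of_real (1 / N) - (\<Sum>(l, j)\<in>{..<m} \<times> F. b l i j * (w i x *\<^sub>R y l j x)))"
    proof (intro sum.cong refl)
      fix x assume "x \<in> E"
      then have x: "x < 2 ^ n k" by (simp add: E_def)
      have "w i x *\<^sub>R (of_real (w i x / N) :: 'k) = of_real (1 / N)"
        by (simp add: w_def scaleR_conv_of_real flip: of_real_mult)
      then show "w i x *\<^sub>R dyint (n k) x (wal (v i) - T) =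
          of_real (1 / N) - (\<Sum>(l, j)\<in>{..<m} \<times> F. b l i j * (w i x *\<^sub>R y l j x))"
        by (simp add: dT[OF x] scaleR_diff_right scaleR_sum_right split_def mult_scaleR_right del: of_real_divide)
    qed
    also have "\<dots> = of_real (real (card E) / N) - (\<Sum>(l, j)\<in>{..<m} \<times> F. b l i j * c l j i)"
      unfolding sum_subtractf c_def
      by (subst sum.swap) (simp add: split_def sum_distrib_left)
    finally have eq: "(\<Sum>x\<in>E. w i x *\<^sub>R dyint (n k) x (wal (v i) - T))
        = of_real (real (card E) / N) - (\<Sum>(l, j)\<in>{..<m} \<times> F. b l i j * c l j i)" .
    have "norm (\<Sum>x\<in>E. w i x *\<^sub>R dyint (n k) x (wal (v i) - T)) \<le> (\<Sum>x\<in>E. norm (dyint (n k) x (wal (v i) - T)))"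
      by (rule order_trans[OF norm_sum]) (simp add: w_def)
    also have "\<dots> \<le> (\<Sum>x<2 ^ n k. norm (dyint (n k) x (wal (v i) - T)))"
      using E by (intro sum_mono2) auto
    also have "\<dots> \<le> norm (wal (v i) - T)" by (rule sum_norm_dyint_grid_le)
    also have "\<dots> < 1 / 2" using n0[OF i] by (simp add: T_def F_def)
    finally have "norm (of_real (real (card E) / N) :: 'k) < 1 / 2 + norm (\<Sum>(l, j)\<in>{..<m} \<times> F. b l i j * c l j i)"
      unfolding eq by (smt (verit) norm_triangle_sub norm_minus_commute)
    moreover have "3 / 4 \<le> norm (of_real (real (card E) / N) :: 'k)"
      unfolding norm_of_real using card_E N by (simp add: field_simps)
    moreover have "norm (\<Sum>(l, j)\<in>{..<m} \<times> F. b l i j * c l j i)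
        \<le> (\<Sum>(l, j)\<in>{..<m} \<times> F. norm (b l i j) * norm (c l j i))"
      unfolding split_def by (rule order_trans[OF norm_sum]) (simp add: norm_mult)
    ultimately have "1 / 4 \<le> (\<Sum>(l, j)\<in>{..<m} \<times> F. norm (b l i j) * norm (c l j i))" by linarith
    then have "(1 / 4)\<^sup>2 \<le> (\<Sum>(l, j)\<in>{..<m} \<times> F. norm (b l i j) * norm (c l j i))\<^sup>2"
      by (intro power_mono) auto
    also have "\<dots> \<le> (\<Sum>(l, j)\<in>{..<m} \<times> F. (norm (b l i j))\<^sup>2) * (\<Sum>(l, j)\<in>{..<m} \<times> F. (norm (c l j i))\<^sup>2)"
      unfolding split_def by (rule Cauchy_Schwarz_ineq_sum)
    also have "\<dots> \<le> (real m * C)\<^sup>2 * (\<Sum>(l, j)\<in>{..<m} \<times> F. (norm (c l j i))\<^sup>2)"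
    proof (rule mult_right_mono)
      have "(\<Sum>(l, j)\<in>{..<m} \<times> F. (norm (b l i j))\<^sup>2) \<le> (\<Sum>(l, j)\<in>{..<m} \<times> F. norm (b l i j))\<^sup>2"
        unfolding split_def using F by (intro sum_square_le_square_sum) auto
      also have "\<dots> \<le> (real m * C)\<^sup>2"
      proof (rule power_mono)
        have "(\<Sum>j\<in>F. norm (b l i j)) \<le> C" if "l < m" for l
        proof -
          have "(\<Sum>j\<in>F. norm (b l i j)) \<le> (\<Sum>j<n0. norm (b l i j))"
            by (intro sum_mono2) (auto simp: F_def)
          also have "\<dots> \<le> norm (B l (bump i))" unfolding b_def by (rule sum_norm_coef_le)
          also have "\<dots> \<le> C" using norm_blinfun[of "B l" "bump i"] B[OF that] by simp
          finally show ?thesis .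
        qed
        then have "(\<Sum>l<m. \<Sum>j\<in>F. norm (b l i j)) \<le> (\<Sum>l<m. C)" by (intro sum_mono) auto
        then show "(\<Sum>(l, j)\<in>{..<m} \<times> F. norm (b l i j)) \<le> real m * C"
          by (simp add: sum.cartesian_product[symmetric])
      qed (auto intro!: sum_nonneg)
      finally show "(\<Sum>(l, j)\<in>{..<m} \<times> F. (norm (b l i j))\<^sup>2) \<le> (real m * C)\<^sup>2" .
    qed (auto intro!: sum_nonneg)
    finally show ?thesis by (simp add: power2_eq_square)
  qed
  define D where "D = real (R k) + (1 + fact (2 * h k))\<^sup>2 * (real (\<beta> k))\<^sup>2"
  have point: "(\<Sum>j\<in>F. (norm (y l j x))\<^sup>2) \<le> real DIM('k) * (4 * real m * C / N)\<^sup>2 * D" if l: "l < m" and x: "x \<in> E" for l x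
  proof -
    define \<kappa> where "\<kappa> = 4 * real m * C / N"
    have \<tau>: "\<tau> l x \<le> \<kappa>" using l x by (simp add: E_def \<kappa>_def)
    have \<tau>0: "0 \<le> \<tau> l x" by (simp add: \<tau>_def sum_nonneg)
    define F1 where "F1 = F \<inter> {..<R k}"
    define F2 where "F2 = F \<inter> {R (Suc k)..}"
    have "F = F1 \<union> F2" using S by (auto simp: F1_def F2_def F_def)
    moreover have "F1 \<inter> F2 = {}" using R_less[of k] by (auto simp: F1_def F2_def)
    ultimately have split: "(\<Sum>j\<in>F. (norm (y l j x))\<^sup>2) = (\<Sum>j\<in>F1. (norm (y l j x))\<^sup>2) + (\<Sum>j\<in>F2. (norm (y l j x))\<^sup>2)"
      using F by (metis finite_Un sum.union_disjoint)
    have "(\<Sum>j\<in>F1. (norm (y l j x))\<^sup>2) \<le> (\<Sum>j\<in>F1. \<kappa>\<^sup>2)"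
    proof (intro sum_mono power_mono)
      fix j assume "j \<in> F1"
      then have "norm (y l j x) \<le> \<tau> l x"
        unfolding \<tau>_def by (subst y_eq) (auto simp: F1_def intro!: order_trans[OF norm_sum] sum_mono)
      with \<tau> show "norm (y l j x) \<le> \<kappa>" by simp
    qed simp
    also have "\<dots> = real (card F1) * \<kappa>\<^sup>2" by simp
    also have "\<dots> \<le> real (R k) * \<kappa>\<^sup>2"
      using card_mono[of "{..<R k}" F1] by (intro mult_right_mono) (auto simp: F1_def)
    also have "\<dots> \<le> real DIM('k) * (real (R k) * \<kappa>\<^sup>2)"
      using mult_right_mono[of 1 "real DIM('k)" "real (R k) * \<kappa>\<^sup>2"] DIM_positive[where 'a = 'k]
      by (simp add: Suc_le_eq)
    finally have 1: "(\<Sum>j\<in>F1. (norm (y l j x))\<^sup>2) \<le> real DIM('k) * (real (R k) * \<kappa>\<^sup>2)" .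
    have "(\<Sum>j\<in>F2. (norm (y l j x))\<^sup>2) = (\<Sum>j\<in>F2. \<Sum>e\<in>Basis. (y l j x \<bullet> e)\<^sup>2)"
    proof (intro sum.cong refl)
      show "(norm (y l j x))\<^sup>2 = (\<Sum>e\<in>Basis. (y l j x \<bullet> e)\<^sup>2)" for j
        unfolding power2_norm_eq_inner by (subst euclidean_inner) (simp add: power2_eq_square)
    qed
    also have "\<dots> = (\<Sum>e\<in>Basis. \<Sum>j\<in>F2. (y l j x \<bullet> e)\<^sup>2)" by (rule sum.swap)
    also have "\<dots> \<le> (\<Sum>e\<in>(Basis :: 'k set). \<kappa>\<^sup>2 * ((1 + fact (2 * h k))\<^sup>2 * (real (\<beta> k))\<^sup>2))"
    proof (rule sum_mono)
      fix e :: 'k assume e: "e \<in> Basis"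
      define \<theta> where "\<theta> q = a l x q \<bullet> e" for q
      have \<theta>: "\<bar>\<theta> q\<bar> \<le> norm (a l x q)" for q
        unfolding \<theta>_def using e by (rule Basis_le_norm)
      have "(\<Sum>j\<in>F2. (y l j x \<bullet> e)\<^sup>2) = (\<Sum>j\<in>F2. (\<Sum>q<2 ^ n'. walsh (v j) (real q / 2 ^ n') * \<theta> q)\<^sup>2)"
        by (intro sum.cong refl) (simp add: y_eq F2_def inner_sum_left \<theta>_def)
      also have "\<dots> \<le> (real (\<beta> k) * \<tau> l x + C * fact (2 * h k) / real (\<beta> k) ^ (2 * h k - 1))\<^sup>2"
      proof (rule sum_square_later_blocks_le)
        show "\<bar>\<theta> q\<bar> \<le> C / 2 ^ n'" if "q < 2 ^ n'" for q
          using \<theta>[of q] a_le[OF l that] by (rule order_trans)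
        show "(\<Sum>q<2 ^ n'. \<bar>\<theta> q\<bar>) \<le> \<tau> l x" unfolding \<tau>_def by (intro sum_mono \<theta>)
      qed (use F n' C in \<open>auto simp: F2_def\<close>)
      also have "\<dots> \<le> (\<kappa> * ((1 + fact (2 * h k)) * real (\<beta> k)))\<^sup>2"
      proof (rule power_mono)
        have N\<beta>: "N = real (\<beta> k) ^ (2 * h k - 1) * real (\<beta> k)"
        proof -
          have "N = real (2 ^ n k)" by (simp add: N_def)
          also have "\<dots> = real (\<beta> k) ^ (2 * h k)" by (simp only: grid of_nat_power)
          finally show ?thesis using h_pos[of k] by (simp flip: power_Suc2)
        qed
        then have \<beta>: "\<beta> k > 0" using N by (cases "\<beta> k = 0") auto
        have "C * fact (2 * h k) / real (\<beta> k) ^ (2 * h k - 1) = C / N * (fact (2 * h k) * real (\<beta> k))"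
          using \<beta> by (simp add: N\<beta>)
        also have "\<dots> \<le> \<kappa> * (fact (2 * h k) * real (\<beta> k))"
          using l C N by (intro mult_right_mono) (auto simp: \<kappa>_def field_simps)
        finally show "real (\<beta> k) * \<tau> l x + C * fact (2 * h k) / real (\<beta> k) ^ (2 * h k - 1) \<le> \<kappa> * ((1 + fact (2 * h k)) * real (\<beta> k))"
          using mult_left_mono[OF \<tau>, of "real (\<beta> k)"] by (simp add: algebra_simps)
        show "0 \<le> real (\<beta> k) * \<tau> l x + C * fact (2 * h k) / real (\<beta> k) ^ (2 * h k - 1)"
          using \<tau>0 C by simp
      qed
      finally show "(\<Sum>j\<in>F2. (y l j x \<bullet> e)\<^sup>2) \<le> \<kappa>\<^sup>2 * ((1 + fact (2 * h k))\<^sup>2 * (real (\<beta> k))\<^sup>2)"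
        by (simp add: power_mult_distrib)
    qed
    also have "\<dots> = real DIM('k) * (\<kappa>\<^sup>2 * ((1 + fact (2 * h k))\<^sup>2 * (real (\<beta> k))\<^sup>2))" by simp
    finally show ?thesis using 1 split unfolding D_def \<kappa>_def[symmetric] by (simp add: algebra_simps)
  qed
  have "real (card bl) * (1 / 16) \<le> (\<Sum>i\<in>bl. (real m * C)\<^sup>2 * (\<Sum>(l, j)\<in>{..<m} \<times> F. (norm (c l j i))\<^sup>2))"
    using sum_mono[OF each, of bl "\<lambda>i. i"] by simp
  also have "\<dots> = (real m * C)\<^sup>2 * (\<Sum>(l, j)\<in>{..<m} \<times> F. \<Sum>i\<in>bl. (norm (c l j i))\<^sup>2)"
    unfolding split_def sum_distrib_left[symmetric] by (subst sum.swap) rule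
  also have "\<dots> \<le> (real m * C)\<^sup>2 * (\<Sum>(l, j)\<in>{..<m} \<times> F. N * (\<Sum>x\<in>E. (norm (y l j x))\<^sup>2))"
    unfolding split_def c_def
    by (intro mult_left_mono sum_mono bessel[of bl "{..<2 ^ n k}"] \<open>finite bl\<close> E N orth) auto
  also have "\<dots> = (real m * C)\<^sup>2 * (N * (\<Sum>l<m. \<Sum>x\<in>E. \<Sum>j\<in>F. (norm (y l j x))\<^sup>2))"
    by (simp add: sum.cartesian_product[symmetric] sum_distrib_left[symmetric] sum.swap[of _ E F])
  also have "\<dots> \<le> (real m * C)\<^sup>2 * (N * (\<Sum>l<m. \<Sum>x\<in>E. real DIM('k) * (4 * real m * C / N)\<^sup>2 * D))"
    using N by (intro mult_left_mono sum_mono point) auto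
  also have "\<dots> = (real m * C)\<^sup>2 * (N * (real m * (real (card E) * (real DIM('k) * (4 * real m * C / N)\<^sup>2 * D))))" by simp
  also have "\<dots> \<le> (real m * C)\<^sup>2 * (N * (real m * (N * (real DIM('k) * (4 * real m * C / N)\<^sup>2 * D))))"
  proof -
    have "real (card E) \<le> N" using card_mono[OF _ E(2)] by (simp add: N_def)
    moreover have "0 \<le> D" by (simp add: D_def)
    ultimately show ?thesis using N by (intro mult_left_mono mult_right_mono) auto
  qed
  also have "\<dots> = (real m * C)\<^sup>2 * real m * real DIM('k) * (4 * real m * C)\<^sup>2 * D"
    using N by (simp add: power2_eq_square)
  finally show ?thesis by (simp add: D_def bl_def)
qed

text \<open>An element of the ideal at distance less than \<open>1/2\<close> approximates every block of \<open>S'\<close>, so the preceding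
  bound holds with one constant for infinitely many \<open>k\<close>; the growth condition on block \<open>k\<close> excludes this
  as soon as \<open>k\<close> exceeds the constant.\<close>

lemma block_op_notin_closure:
  assumes blocks: "\<And>K. \<exists>k\<ge>K. {R k..<R (Suc k)} \<subseteq> S' \<and> S \<inter> {R k..<R (Suc k)} = {}"
  shows "(block_op S' :: 'k::{real_normed_field, euclidean_space} L1_map) \<notin> closure (factor_ideal (block_op S))"
proof
  assume "(block_op S' :: 'k L1_map) \<in> closure (factor_ideal (block_op S))"
  then obtain T :: "'k L1_map" where T: "T \<in> factor_ideal (block_op S)" "dist T (block_op S') < 1 / 2"
    unfolding closure_approachable by (meson half_gt_zero zero_less_one)
  obtain m :: nat and A B where AB: "\<And>l. l < m \<Longrightarrow> A l \<in> L1_ops \<and> B l \<in> L1_ops"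
    "T = (\<Sum>l<m. A l o\<^sub>L block_op S o\<^sub>L B l)"
    using T(1) unfolding factor_ideal_def by blast
  define C where "C = 1 + (\<Sum>l<m. norm (A l)) + (\<Sum>l<m. norm (B l))"
  have "norm (A l) \<le> (\<Sum>l<m. norm (A l))" "norm (B l) \<le> (\<Sum>l<m. norm (B l))" if "l < m" for l
    using that by (auto intro: member_le_sum)
  then have AC: "norm (A l) \<le> C" and BC: "norm (B l) \<le> C" if "l < m" for l
    unfolding C_def using that by (smt (verit) norm_ge_zero sum_nonneg)+
  have C: "C > 0" unfolding C_def by (smt (verit) norm_ge_zero sum_nonneg)
  define K where "K = 16 * (real m * C)\<^sup>2 * real m * real DIM('k) * (4 * real m * C)\<^sup>2"
  obtain K' :: nat where K': "K \<le> real K'" using real_arch_simple by blast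
  obtain k where k: "k \<ge> K'" "{R k..<R (Suc k)} \<subseteq> S'" "S \<inter> {R k..<R (Suc k)} = {}"
    using blocks by blast
  define D where "D = R k + (1 + fact (2 * h k))\<^sup>2 * (\<beta> k)\<^sup>2"
  have "real (R (Suc k) - R k) \<le> K * (real (R k) + (1 + fact (2 * h k))\<^sup>2 * (real (\<beta> k))\<^sup>2)"
    unfolding K_def
  proof (rule block_obstruction[OF _ AC BC C k(3)])
    fix i assume "R k \<le> i" "i < R (Suc k)"
    then have "(wal (v i) :: 'k L1) = block_op S' (bump i)" using k(2) by (subst block_op_bump) auto
    then have "norm (wal (v i) - T (bump i)) \<le> norm (block_op S' - T)"
      using norm_blinfun[of "block_op S' - T" "bump i"] by (simp add: blinfun.diff_left)
    also have "\<dots> < 1 / 2" using T(2) by (simp add: dist_norm norm_minus_commute)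
    finally show "norm (wal (v i) - (\<Sum>l<m. A l o\<^sub>L block_op S o\<^sub>L B l) (bump i)) < 1 / 2" by (simp add: AB(2))
  qed (use AB in auto)
  also have "real (R k) + (1 + fact (2 * h k))\<^sup>2 * (real (\<beta> k))\<^sup>2 = real D"
    by (simp add: D_def)
  also have "K * real D \<le> real (k + 1) * D" using K' k(1) by (intro mult_right_mono) auto
  also have "\<dots> < real ((k + 1) * (D + 1))" by (simp add: algebra_simps)
  also have "(k + 1) * (D + 1) \<le> R (Suc k) - R k"
    using large[of k] by (simp add: D_def algebra_simps)
  finally show False by simp
qed

end

section \<open>A continuum of ideals\<close>

text \<open>Both scalar fields are covered by treating a scalar field that is at the same time a Euclidean space.\<close>

lemma continuum_of_small_ideals:
  "\<exists>I :: real \<Rightarrow> 'k::{real_normed_field, euclidean_space} L1_map set.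
     (\<forall>p>2. L1_ideal (I p) \<and> \<not> closed (I p) \<and> small_ideal (closure (I p))) \<and>
     (\<forall>p>2. \<forall>q>2. p \<noteq> q \<longrightarrow> closure (I p) \<noteq> closure (I q))"
proof -
  obtain v R n h \<beta> where "walsh_blocks v R n h \<beta>" using walsh_blocks_exist by blast
  then interpret walsh_blocks v R n h \<beta> .
  have R: "strict_mono R" by (simp add: strict_mono_Suc_iff R_less)
  \<comment> \<open>decoding a pair makes every rational occur for infinitely many \<open>k\<close>\<close>
  define r :: "nat \<Rightarrow> real" where "r k = of_rat (from_nat (fst (prod_decode k)))" for k
  define S where "S p = (\<Union>k\<in>{k. r k < p}. {R k..<R (Suc k)})" for p
  define I :: "real \<Rightarrow> 'k L1_map set" where "I p = factor_ideal (block_op (S p))" for p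
  have often: "\<exists>k\<ge>K. p < r k \<and> r k < q" if pq: "p < q" for p q K
  proof -
    obtain u where u: "p < of_rat u" "of_rat u < q" using of_rat_dense[OF pq] by blast
    have "r (prod_encode (to_nat u, K)) = of_rat u" by (simp add: r_def)
    moreover have "prod_encode (to_nat u, K) \<ge> K" by (rule le_prod_encode_2)
    ultimately show ?thesis using u by metis
  qed
  have disj: "{R k..<R (Suc k)} \<inter> {R j..<R (Suc j)} = {}" if "k \<noteq> j" for k j
  proof -
    have "R (Suc k) \<le> R j \<or> R (Suc j) \<le> R k"
      using that strict_mono_less_eq[OF R] by (metis Suc_leI linorder_neqE_nat)
    then show ?thesis by auto
  qed
  have notin: "block_op (S q) \<notin> closure (I p)" if pq: "p < q" for p q
    unfolding I_def
  proof (rule block_op_notin_closure)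
    fix K
    obtain k where k: "k \<ge> K" "p < r k" "r k < q" using often[OF pq] by blast
    have "S p \<inter> {R k..<R (Suc k)} = {}"
    proof -
      have "{R j..<R (Suc j)} \<inter> {R k..<R (Suc k)} = {}" if "r j < p" for j
        using that k(2) by (intro disj) auto
      then show ?thesis unfolding S_def by blast
    qed
    then show "\<exists>k\<ge>K. {R k..<R (Suc k)} \<subseteq> S q \<and> S p \<inter> {R k..<R (Suc k)} = {}"
      using k by (auto simp: S_def)
  qed
  have "\<not> closed (I p)" for p
  proof -
    obtain k where "r k < p" using often[of "p - 1" p] by auto
    then have "R k \<in> S p" using R_less[of k] by (auto simp: S_def)
    then have "slow_diagonal \<in> closure (I p)"
      unfolding I_def by (intro slow_diagonal_in_closure[OF block_op_bump finite_v block_op_in_L1_ops])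
    moreover have "slow_diagonal \<notin> I p"
      unfolding I_def by (rule slow_diagonal_notin[OF hilbertian_block_op])
    ultimately show ?thesis by (metis closure_closed)
  qed
  moreover have "L1_ideal (I p)" "small_ideal (closure (I p))" for p
    unfolding I_def
    by (intro L1_ideal_factor_ideal small_ideal_closure_factor_ideal block_op_in_L1_ops hilbertian_block_op)+
  moreover have "closure (I p) \<noteq> closure (I q)" if "p \<noteq> q" for p q
  proof -
    have "block_op (S p) \<in> closure (I p)" for p
      unfolding I_def using factor_ideal_self closure_subset by blast
    then show ?thesis using notin that by (metis linorder_neqE_linordered_idom)
  qed
  ultimately show ?thesis by blast
qed

theorem theorem3p1:
  shows "(\<exists>I :: real \<Rightarrow> real L1_map set.
            (\<forall>p>2. L1_ideal (I p) \<and> \<not> closed (I p) \<and> small_ideal (closure (I p))) \<and>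
            (\<forall>p>2. \<forall>q>2. p \<noteq> q \<longrightarrow> closure (I p) \<noteq> closure (I q)))
       \<and> (\<exists>I :: real \<Rightarrow> complex L1_map set.
            (\<forall>p>2. L1_ideal (I p) \<and> \<not> closed (I p) \<and> small_ideal (closure (I p))) \<and>
            (\<forall>p>2. \<forall>q>2. p \<noteq> q \<longrightarrow> closure (I p) \<noteq> closure (I q)))"
  by (intro conjI continuum_of_small_ideals)

end
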